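(* Let $W$ be the Weyl group of a connected semisimple algebraic group $G$ with respect to a maximal torus $T$ and Borel subgroup $B\supset T$, let $P\supseteq B$ be a parabolic subgroup, and let $w\in W^P$ be a Coxeter-type element. Then the interval $[e,w]_{W^P}=\{v\in W^P: v\le w\}$ (with the Bruhat order) is isomorphic to the poset, ordered by inclusion, of feasible sets of a supersolvable antimatroid. In particular, $[e,w]_{W^P}$ is a supersolvable join-distributive lattice, hence a supersolvable lattice.
   Context: $W^P$ is the set of minimal-length representatives of $W/W_P$, where $W_P$ is generated by simple reflections $s_\alpha$ with $U_\alpha\subset P$; $\le$ is the Bruhat order. An element of $W$ is of Coxeter type if it is a product of pairwise distinct simple reflections. Supersolvable antimatroid (Armstrong): a triple $(E,\mathcal F,\preccurlyeq)$ with $E$ a finite set, $\preccurlyeq$ a total order on $E$, $\mathcal F\subseteq 2^E$ with $\emptyset\in\mathcal F$, such that whenever $A,B\in\mathcal F$ with $B\not\subseteq A$ and $x=\min_{\preccurlyeq}(B\setminus A)$, one has $A\cup\{x\}\in\mathcal F$; elements of $\mathcal F$ are the feasible sets. A finite lattice $L$ is supersolvable if it has a maximal chain $\mathfrak m$ such that for every chain $\mathfrak c$ of $L$ the sublattice generated by $\mathfrak m\cup\mathfrak c$ is distributive. A finite lattice is join-distributive if it is semimodular and every interval $[x,y]$ in which $y$ is the join of the elements covering $x$ is a Boolean lattice (equivalently, it is the lattice of feasible sets of an antimatroid). *)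

theory Defs
  imports "HOL-Analysis.Analysis" "HOL-Algebra.Lattice" "HOL-Algebra.Bij"
    "HOL-Algebra.Generated_Groups"
begin

text \<open>
  Weyl groups of connected semisimple algebraic groups are given through their root systems.
  A pair $(G, T)$ corresponds to a reduced crystallographic root system \<open>\<Phi>\<close>, a Borel subgroup
  $B \supset T$ to a base \<open>\<Delta>\<close> of \<open>\<Phi>\<close> (the $U_\alpha \subset B$ being those with \<open>\<alpha>\<close> positive),
  and a parabolic subgroup $P \supseteq B$ to the set \<open>\<Psi>\<close> of all roots \<open>\<alpha>\<close> with
  $U_\alpha \subset P$, which is an arbitrary closed set of roots containing the positive ones.
\<close>

definition root_reflection :: "'a::euclidean_space \<Rightarrow> 'a \<Rightarrow> 'a" where
  "root_reflection \<alpha> = (\<lambda>x. x - (2 * (x \<bullet> \<alpha>) / (\<alpha> \<bullet> \<alpha>)) *\<^sub>R \<alpha>)"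

text \<open>
  The Euclidean space of the root system is \<open>span \<Phi>\<close> rather than the whole type, so that rank
  zero (\<open>\<Phi> = {}\<close>, trivial $G$) is included. Reflections fix the orthogonal complement of
  \<open>span \<Phi>\<close> pointwise, so the group they generate is the same on either space.
\<close>

definition root_system :: "'a::euclidean_space set \<Rightarrow> bool" where
  "root_system \<Phi> \<longleftrightarrow>
     finite \<Phi> \<and> 0 \<notin> \<Phi> \<and>
     (\<forall>\<alpha>\<in>\<Phi>. \<forall>\<beta>\<in>\<Phi>. root_reflection \<alpha> \<beta> \<in> \<Phi>) \<and>
     (\<forall>\<alpha>\<in>\<Phi>. \<forall>\<beta>\<in>\<Phi>. 2 * (\<beta> \<bullet> \<alpha>) / (\<alpha> \<bullet> \<alpha>) \<in> \<int>) \<and>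
     (\<forall>\<alpha>\<in>\<Phi>. \<forall>c::real. c *\<^sub>R \<alpha> \<in> \<Phi> \<longrightarrow> c = 1 \<or> c = -1)"

definition positive_roots :: "'a::euclidean_space set \<Rightarrow> 'a set \<Rightarrow> 'a set" where
  "positive_roots \<Phi> \<Delta> = {\<beta>\<in>\<Phi>. \<exists>c::'a \<Rightarrow> nat. \<beta> = (\<Sum>\<alpha>\<in>\<Delta>. real (c \<alpha>) *\<^sub>R \<alpha>)}"

definition root_base :: "'a::euclidean_space set \<Rightarrow> 'a set \<Rightarrow> bool" where
  "root_base \<Phi> \<Delta> \<longleftrightarrow>
     \<Delta> \<subseteq> \<Phi> \<and> independent \<Delta> \<and>
     (\<forall>\<beta>\<in>\<Phi>. \<beta> \<in> positive_roots \<Phi> \<Delta> \<or> - \<beta> \<in> positive_roots \<Phi> \<Delta>)"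

definition standard_parabolic :: "'a::euclidean_space set \<Rightarrow> 'a set \<Rightarrow> 'a set \<Rightarrow> bool" where
  "standard_parabolic \<Phi> \<Delta> \<Psi> \<longleftrightarrow>
     positive_roots \<Phi> \<Delta> \<subseteq> \<Psi> \<and> \<Psi> \<subseteq> \<Phi> \<and>
     (\<forall>\<alpha>\<in>\<Psi>. \<forall>\<beta>\<in>\<Psi>. \<alpha> + \<beta> \<in> \<Phi> \<longrightarrow> \<alpha> + \<beta> \<in> \<Psi>)"

definition weyl_group :: "'a::euclidean_space set \<Rightarrow> ('a \<Rightarrow> 'a) set" where
  "weyl_group \<Phi> = generate (BijGroup UNIV) (root_reflection ` \<Phi>)"

text \<open>
  With the positive root subgroups in $B$, the simple reflections belonging to $P$ are the
  $s_\alpha$ for which the \<^emph>\<open>negative\<close> root subgroup $U_{-\alpha}$ lies in $P$; the positive one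
  always does.
\<close>

definition parabolic_weyl :: "'a::euclidean_space set \<Rightarrow> 'a set \<Rightarrow> ('a \<Rightarrow> 'a) set" where
  "parabolic_weyl \<Delta> \<Psi> =
     generate (BijGroup UNIV) (root_reflection ` {\<alpha>\<in>\<Delta>. - \<alpha> \<in> \<Psi>})"

definition word_prod :: "('a \<Rightarrow> 'a) list \<Rightarrow> 'a \<Rightarrow> 'a" where
  "word_prod ss = foldr (\<circ>) ss id"

definition weyl_length :: "'a::euclidean_space set \<Rightarrow> ('a \<Rightarrow> 'a) \<Rightarrow> nat" where
  "weyl_length \<Delta> w =
     (LEAST n. \<exists>ss. set ss \<subseteq> root_reflection ` \<Delta> \<and> word_prod ss = w \<and> length ss = n)"

definition bruhat_step ::
    "'a::euclidean_space set \<Rightarrow> 'a set \<Rightarrow> ('a \<Rightarrow> 'a) \<Rightarrow> ('a \<Rightarrow> 'a) \<Rightarrow> bool" where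
  "bruhat_step \<Phi> \<Delta> u v \<longleftrightarrow>
     u \<in> weyl_group \<Phi> \<and> (\<exists>\<beta>\<in>\<Phi>. v = u \<circ> root_reflection \<beta>) \<and>
     weyl_length \<Delta> u < weyl_length \<Delta> v"

definition bruhat_le ::
    "'a::euclidean_space set \<Rightarrow> 'a set \<Rightarrow> ('a \<Rightarrow> 'a) \<Rightarrow> ('a \<Rightarrow> 'a) \<Rightarrow> bool" where
  "bruhat_le \<Phi> \<Delta> = (bruhat_step \<Phi> \<Delta>)\<^sup>*\<^sup>*"

definition min_coset_reps ::
    "'a::euclidean_space set \<Rightarrow> 'a set \<Rightarrow> 'a set \<Rightarrow> ('a \<Rightarrow> 'a) set" where
  "min_coset_reps \<Phi> \<Delta> \<Psi> =
     {w \<in> weyl_group \<Phi>. \<forall>u\<in>parabolic_weyl \<Delta> \<Psi>. weyl_length \<Delta> w \<le> weyl_length \<Delta> (w \<circ> u)}"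

definition coxeter_type :: "'a::euclidean_space set \<Rightarrow> ('a \<Rightarrow> 'a) \<Rightarrow> bool" where
  "coxeter_type \<Delta> w \<longleftrightarrow>
     (\<exists>ss. distinct ss \<and> set ss \<subseteq> root_reflection ` \<Delta> \<and> w = word_prod ss)"

definition bruhat_interval ::
    "'a::euclidean_space set \<Rightarrow> 'a set \<Rightarrow> 'a set \<Rightarrow> ('a \<Rightarrow> 'a) \<Rightarrow> ('a \<Rightarrow> 'a) gorder" where
  "bruhat_interval \<Phi> \<Delta> \<Psi> w =
     \<lparr>carrier = {v \<in> min_coset_reps \<Phi> \<Delta> \<Psi>. bruhat_le \<Phi> \<Delta> v w},
      eq = (=), le = bruhat_le \<Phi> \<Delta>\<rparr>"

definition supersolvable_antimatroid :: "'e set \<Rightarrow> 'e set set \<Rightarrow> 'e rel \<Rightarrow> bool" where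
  "supersolvable_antimatroid E F r \<longleftrightarrow>
     finite E \<and> linear_order_on E r \<and> F \<subseteq> Pow E \<and> {} \<in> F \<and>
     (\<forall>A\<in>F. \<forall>B\<in>F. \<forall>x\<in>B - A. (\<forall>y\<in>B - A. (x, y) \<in> r) \<longrightarrow> insert x A \<in> F)"

definition inclusion_order :: "'e set set \<Rightarrow> 'e set gorder" where
  "inclusion_order F = \<lparr>carrier = F, eq = (=), le = (\<subseteq>)\<rparr>"

definition order_iso :: "('a, 'c) gorder_scheme \<Rightarrow> ('b, 'd) gorder_scheme \<Rightarrow> ('a \<Rightarrow> 'b) \<Rightarrow> bool"
  where "order_iso L M f \<longleftrightarrow> order_emb L M f \<and> bij_betw f (carrier L) (carrier M)"

definition chain_in :: "('a, 'c) gorder_scheme \<Rightarrow> 'a set \<Rightarrow> bool" where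
  "chain_in L C \<longleftrightarrow> C \<subseteq> carrier L \<and> (\<forall>x\<in>C. \<forall>y\<in>C. x \<sqsubseteq>\<^bsub>L\<^esub> y \<or> y \<sqsubseteq>\<^bsub>L\<^esub> x)"

definition maximal_chain :: "('a, 'c) gorder_scheme \<Rightarrow> 'a set \<Rightarrow> bool" where
  "maximal_chain L M \<longleftrightarrow> chain_in L M \<and> (\<forall>C. chain_in L C \<and> M \<subseteq> C \<longrightarrow> C = M)"

inductive_set sublattice_generated :: "('a, 'c) gorder_scheme \<Rightarrow> 'a set \<Rightarrow> 'a set"
  for L and X where
    incl: "x \<in> X \<Longrightarrow> x \<in> sublattice_generated L X"
  | join: "x \<in> sublattice_generated L X \<Longrightarrow> y \<in> sublattice_generated L X \<Longrightarrow>
      x \<squnion>\<^bsub>L\<^esub> y \<in> sublattice_generated L X"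
  | meet: "x \<in> sublattice_generated L X \<Longrightarrow> y \<in> sublattice_generated L X \<Longrightarrow>
      x \<sqinter>\<^bsub>L\<^esub> y \<in> sublattice_generated L X"

definition distributive_on :: "('a, 'c) gorder_scheme \<Rightarrow> 'a set \<Rightarrow> bool" where
  "distributive_on L K \<longleftrightarrow>
     (\<forall>x\<in>K. \<forall>y\<in>K. \<forall>z\<in>K. x \<sqinter>\<^bsub>L\<^esub> (y \<squnion>\<^bsub>L\<^esub> z) = (x \<sqinter>\<^bsub>L\<^esub> y) \<squnion>\<^bsub>L\<^esub> (x \<sqinter>\<^bsub>L\<^esub> z))"

definition finite_lattice :: "('a, 'c) gorder_scheme \<Rightarrow> bool" where
  "finite_lattice L \<longleftrightarrow> lattice L \<and> finite (carrier L) \<and> carrier L \<noteq> {}"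

definition supersolvable_lattice :: "('a, 'c) gorder_scheme \<Rightarrow> bool" where
  "supersolvable_lattice L \<longleftrightarrow>
     finite_lattice L \<and>
     (\<exists>M. maximal_chain L M \<and>
        (\<forall>C. chain_in L C \<longrightarrow> distributive_on L (sublattice_generated L (M \<union> C))))"

definition covered_by :: "('a, 'c) gorder_scheme \<Rightarrow> 'a \<Rightarrow> 'a \<Rightarrow> bool" where
  "covered_by L x y \<longleftrightarrow>
     x \<in> carrier L \<and> y \<in> carrier L \<and> x \<sqsubset>\<^bsub>L\<^esub> y \<and>
     \<not> (\<exists>z\<in>carrier L. x \<sqsubset>\<^bsub>L\<^esub> z \<and> z \<sqsubset>\<^bsub>L\<^esub> y)"

definition semimodular :: "('a, 'c) gorder_scheme \<Rightarrow> bool" where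
  "semimodular L \<longleftrightarrow>
     (\<forall>x\<in>carrier L. \<forall>y\<in>carrier L.
        covered_by L (x \<sqinter>\<^bsub>L\<^esub> y) x \<longrightarrow> covered_by L y (x \<squnion>\<^bsub>L\<^esub> y))"

definition boolean_lattice :: "('a, 'c) gorder_scheme \<Rightarrow> bool" where
  "boolean_lattice L \<longleftrightarrow>
     bounded_lattice L \<and> distributive_on L (carrier L) \<and>
     (\<forall>x\<in>carrier L. \<exists>y\<in>carrier L. x \<sqinter>\<^bsub>L\<^esub> y = \<bottom>\<^bsub>L\<^esub> \<and> x \<squnion>\<^bsub>L\<^esub> y = \<top>\<^bsub>L\<^esub>)"

definition interval_order :: "('a, 'c) gorder_scheme \<Rightarrow> 'a \<Rightarrow> 'a \<Rightarrow> ('a, 'c) gorder_scheme" where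
  "interval_order L x y = L\<lparr>carrier := \<lbrace>x..y\<rbrace>\<^bsub>L\<^esub>\<rparr>"

text \<open>
  The join and the covering elements are taken within the interval \<open>[x, y]\<close>. This includes the
  case where \<open>y\<close> is the join of all elements of \<open>L\<close> that cover \<open>x\<close>, as these then lie in the
  interval.
\<close>

definition join_distributive_lattice :: "('a, 'c) gorder_scheme \<Rightarrow> bool" where
  "join_distributive_lattice L \<longleftrightarrow>
     finite_lattice L \<and> semimodular L \<and>
     (\<forall>x\<in>carrier L. \<forall>y\<in>carrier L. x \<sqsubseteq>\<^bsub>L\<^esub> y \<longrightarrow>
        is_lub (interval_order L x y) y {z \<in> \<lbrace>x..y\<rbrace>\<^bsub>L\<^esub>. covered_by L x z} \<longrightarrow>
        boolean_lattice (interval_order L x y))"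

end

theory Submission
  imports Defs
begin

text \<open>
  Write $w = s_1 \cdots s_n$ with distinct simple reflections. By the strong exchange property, the
  elements below \<open>w\<close> are the products $w_A$ of the subwords at the positions in
  $A \subseteq \{1, \ldots, n\}$, and the Bruhat order among them is inclusion of position sets.
  Let \<open>I\<close> be the set of simple roots of the parabolic. Then $w_A$ is a minimal coset
  representative iff every position in \<open>A\<close> carrying a letter of \<open>I\<close> is followed in \<open>A\<close> by a letter
  that does not commute with it: if some letter of \<open>I\<close> violates this, it can be moved to the end and
  cancelled; otherwise $w_A u$, for \<open>u\<close> in the parabolic subgroup, moves an antidominant vector
  fixed by \<open>u\<close> by a combination of simple roots that is strictly positive on all letters of $w_A$,
  so that no word for $w_A u$ can avoid any of these letters. Such sets \<open>A\<close> form a supersolvable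
  antimatroid for the reversed order of positions.

  In the lattice of feasible sets of a supersolvable antimatroid the join is union. The initial
  segments of the largest feasible set form a maximal chain, and intersecting a feasible set with an
  initial segment gives a feasible set; hence, together with any chain, they generate a lattice of
  sets whose meet is intersection.
\<close>

subsection \<open>Families of sets closed under intersection and union\<close>

definition lattice_of_sets :: "'e set set \<Rightarrow> bool" where
  "lattice_of_sets R \<longleftrightarrow> (\<forall>A\<in>R. \<forall>B\<in>R. A \<inter> B \<in> R \<and> A \<union> B \<in> R)"

lemma lattice_of_setsD:
  assumes "lattice_of_sets R" "A \<in> R" "B \<in> R"
  shows "A \<inter> B \<in> R" "A \<union> B \<in> R"
  using assms by (simp_all add: lattice_of_sets_def)

lemma lattice_of_sets_Unions:
  assumes Int_closed: "\<And>A B. A \<in> G \<Longrightarrow> B \<in> G \<Longrightarrow> A \<inter> B \<in> G"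
  shows "lattice_of_sets (Union ` Pow G)"
  unfolding lattice_of_sets_def
proof (intro ballI)
  fix A B assume "A \<in> Union ` Pow G" "B \<in> Union ` Pow G"
  then obtain U V where A_Union: "U \<subseteq> G" "A = \<Union>U" and B_Union: "V \<subseteq> G" "B = \<Union>V" by blast
  have "A \<inter> B = \<Union>{X \<inter> Y |X Y. X \<in> U \<and> Y \<in> V}" unfolding A_Union(2) B_Union(2) by blast
  moreover have "{X \<inter> Y |X Y. X \<in> U \<and> Y \<in> V} \<subseteq> G" using Int_closed A_Union(1) B_Union(1) by blast
  moreover have "A \<union> B = \<Union>(U \<union> V)" unfolding A_Union(2) B_Union(2) by blast
  moreover have "U \<union> V \<subseteq> G" using A_Union(1) B_Union(1) by blast
  ultimately show "A \<inter> B \<in> Union ` Pow G \<and> A \<union> B \<in> Union ` Pow G" by blast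
qed

lemma chain_subset_Int:
  assumes "chain\<^sub>\<subseteq> \<C>" "A \<in> \<C>" "B \<in> \<C>"
  shows "A \<inter> B \<in> \<C>"
proof -
  have "A \<subseteq> B \<or> B \<subseteq> A" using assms by (simp add: chain_subset_def)
  with assms(2,3) show ?thesis by (auto simp: Int_absorb1 Int_absorb2)
qed

lemma lattice_of_sets_two_chains:
  assumes "chain\<^sub>\<subseteq> \<C>" "chain\<^sub>\<subseteq> \<D>"
  shows "lattice_of_sets (Union ` Pow {C \<inter> D |C D. C \<in> \<C> \<and> D \<in> \<D>})"
proof (rule lattice_of_sets_Unions)
  fix A B assume "A \<in> {C \<inter> D |C D. C \<in> \<C> \<and> D \<in> \<D>}" "B \<in> {C \<inter> D |C D. C \<in> \<C> \<and> D \<in> \<D>}"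
  then obtain C D C' D' where A_Int: "C \<in> \<C>" "D \<in> \<D>" "A = C \<inter> D"
    and B_Int: "C' \<in> \<C>" "D' \<in> \<D>" "B = C' \<inter> D'"
    by blast
  have "A \<inter> B = (C \<inter> C') \<inter> (D \<inter> D')" unfolding A_Int(3) B_Int(3) by blast
  then show "A \<inter> B \<in> {C \<inter> D |C D. C \<in> \<C> \<and> D \<in> \<D>}"
    using chain_subset_Int[OF assms(1) A_Int(1) B_Int(1)]
      chain_subset_Int[OF assms(2) A_Int(2) B_Int(2)] by blast
qed

subsection \<open>Lattices of sets with union as join\<close>

definition family_interior :: "'e set set \<Rightarrow> 'e set \<Rightarrow> 'e set" where
  "family_interior F S = \<Union>{A \<in> F. A \<subseteq> S}"

lemma family_interior_subset: "family_interior F S \<subseteq> S"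
  by (auto simp: family_interior_def)

lemma family_interior_greatest: "A \<in> F \<Longrightarrow> A \<subseteq> S \<Longrightarrow> A \<subseteq> family_interior F S"
  by (auto simp: family_interior_def)

lemma family_interior_eq: "S \<in> F \<Longrightarrow> family_interior F S = S"
  by (simp add: family_interior_subset family_interior_greatest subset_antisym)

lemma order_iso_inclusion_orderI:
  assumes eq: "eq L = (=)" and bij: "bij_betw f (carrier L) F"
    and le_iff: "\<And>x y. x \<in> carrier L \<Longrightarrow> y \<in> carrier L \<Longrightarrow> x \<sqsubseteq>\<^bsub>L\<^esub> y \<longleftrightarrow> f x \<subseteq> f y"
  shows "partial_order L" "order_iso L (inclusion_order F) f"
proof -
  have "f x = f y \<longleftrightarrow> x = y" if "x \<in> carrier L" "y \<in> carrier L" for x y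
    using bij that by (auto simp: bij_betw_def inj_on_def)
  then show "partial_order L" by unfold_locales (auto simp: eq le_iff)
  moreover have "weak_partial_order (inclusion_order F)"
    by unfold_locales (auto simp: inclusion_order_def)
  ultimately show "order_iso L (inclusion_order F) f"
    using bij le_iff
    by (auto simp: order_iso_def order_emb_def inclusion_order_def partial_order_def)
qed

locale set_lattice = partial_order L
  for L :: "('a, 'c) gorder_scheme" (structure) +
  fixes f :: "'a \<Rightarrow> 'e set" and F :: "'e set set"
  assumes iso: "order_iso L (inclusion_order F) f"
    and Un_in_family: "A \<in> F \<Longrightarrow> B \<in> F \<Longrightarrow> A \<union> B \<in> F"
    and interior_in_family: "A \<in> F \<Longrightarrow> B \<in> F \<Longrightarrow> family_interior F (A \<inter> B) \<in> F"
begin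

lemma bij: "bij_betw f (carrier L) F"
  and le_iff: "x \<in> carrier L \<Longrightarrow> y \<in> carrier L \<Longrightarrow> x \<sqsubseteq> y \<longleftrightarrow> f x \<subseteq> f y"
  using iso by (auto simp: order_iso_def order_emb_def inclusion_order_def)

lemma image_in_family: "x \<in> carrier L \<Longrightarrow> f x \<in> F"
  and image_eq_iff: "x \<in> carrier L \<Longrightarrow> y \<in> carrier L \<Longrightarrow> f x = f y \<longleftrightarrow> x = y"
  using bij by (auto simp: bij_betw_def inj_on_def)

lemma ex_preimage: "A \<in> F \<Longrightarrow> \<exists>x\<in>carrier L. f x = A"
  using bij by (auto simp: bij_betw_def)

lemma lless_iff: "x \<in> carrier L \<Longrightarrow> y \<in> carrier L \<Longrightarrow> x \<sqsubset> y \<longleftrightarrow> f x \<subset> f y"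
  by (simp add: lless_eq le_iff psubset_eq image_eq_iff)

lemma least_Upper_pairI:
  assumes "x \<in> carrier L" "y \<in> carrier L" "u \<in> carrier L" "f u = f x \<union> f y"
  shows "least L u (Upper L {x, y})"
  using assms by (auto simp: least_def Upper_def le_iff all_conj_distrib)

lemma greatest_Lower_pairI:
  assumes "x \<in> carrier L" "y \<in> carrier L" "u \<in> carrier L"
    and image_u: "f u = family_interior F (f x \<inter> f y)"
  shows "greatest L u (Lower L {x, y})"
proof (rule greatest_LowerI)
  fix z assume "z \<in> {x, y}"
  then show "u \<sqsubseteq> z"
    using family_interior_subset[of F "f x \<inter> f y"] assms by (auto simp: le_iff)
next
  fix v assume "v \<in> Lower L {x, y}"
  then have lower_v: "v \<in> carrier L" "f v \<subseteq> f x \<inter> f y"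
    using assms(1,2) by (auto simp: Lower_def le_iff all_conj_distrib)
  then have "f v \<subseteq> f u" unfolding image_u by (intro family_interior_greatest image_in_family)
  then show "v \<sqsubseteq> u" using lower_v(1) assms(3) by (simp add: le_iff)
qed (use assms(1-3) in auto)

sublocale lattice L
proof
  fix x y assume xy: "x \<in> carrier L" "y \<in> carrier L"
  then have "f x \<in> F" "f y \<in> F" by (simp_all add: image_in_family)
  then show "\<exists>s. least L s (Upper L {x, y})" "\<exists>s. greatest L s (Lower L {x, y})"
    using ex_preimage[OF Un_in_family, of "f x" "f y"] least_Upper_pairI[OF xy]
      ex_preimage[OF interior_in_family, of "f x" "f y"] greatest_Lower_pairI[OF xy] by blast+
qed

lemma image_join:
  assumes xy: "x \<in> carrier L" "y \<in> carrier L"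
  shows "f (x \<squnion> y) = f x \<union> f y"
proof -
  obtain u where preimage: "u \<in> carrier L" "f u = f x \<union> f y"
    using ex_preimage[OF Un_in_family[OF xy[THEN image_in_family]]] by blast
  have "x \<squnion> y = u"
    unfolding join_def
    using least_unique[OF sup_of_two_least[OF xy] least_Upper_pairI[OF xy preimage]] .
  with preimage(2) show ?thesis by simp
qed

lemma image_meet:
  assumes xy: "x \<in> carrier L" "y \<in> carrier L"
  shows "f (x \<sqinter> y) = family_interior F (f x \<inter> f y)"
proof -
  obtain u where preimage: "u \<in> carrier L" "f u = family_interior F (f x \<inter> f y)"
    using ex_preimage[OF interior_in_family[OF xy[THEN image_in_family]]] by blast
  have "x \<sqinter> y = u"
    unfolding meet_def
    using greatest_unique[OF inf_of_two_greatest[OF xy] greatest_Lower_pairI[OF xy preimage]] .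
  with preimage(2) show ?thesis by simp
qed

lemma image_meet_Int:
  assumes "x \<in> carrier L" "y \<in> carrier L" "f x \<inter> f y \<in> F"
  shows "f (x \<sqinter> y) = f x \<inter> f y"
  using assms by (simp add: image_meet family_interior_eq)

lemma distributive_on_lattice_of_sets:
  assumes K: "K \<subseteq> carrier L" "f ` K \<subseteq> R" and R: "lattice_of_sets R" "R \<subseteq> F"
  shows "distributive_on L K"
  unfolding distributive_on_def
proof (intro ballI)
  fix x y z assume "x \<in> K" "y \<in> K" "z \<in> K"
  with K have in_carrier: "x \<in> carrier L" "y \<in> carrier L" "z \<in> carrier L"
    and in_R: "f x \<in> R" "f y \<in> R" "f z \<in> R"
    by auto
  have "f (x \<sqinter> (y \<squnion> z)) = f x \<inter> (f y \<union> f z)"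
    using in_carrier in_R R(2) lattice_of_setsD[OF R(1)]
    by (subst image_meet_Int) (auto simp: image_join)
  also have "\<dots> = (f x \<inter> f y) \<union> (f x \<inter> f z)" by (rule Int_Un_distrib)
  also have "\<dots> = f (x \<sqinter> y) \<union> f (x \<sqinter> z)"
    using in_carrier in_R R(2) lattice_of_setsD[OF R(1)] by (subst (1 2) image_meet_Int) auto
  also have "\<dots> = f ((x \<sqinter> y) \<squnion> (x \<sqinter> z))" using in_carrier by (simp add: image_join)
  finally show "x \<sqinter> (y \<squnion> z) = (x \<sqinter> y) \<squnion> (x \<sqinter> z)"
    using in_carrier by (simp add: image_eq_iff)
qed

lemma distributive_on_sublattice_generated:
  assumes X: "X \<subseteq> carrier L" "f ` X \<subseteq> R" and R: "lattice_of_sets R" "R \<subseteq> F"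
  shows "distributive_on L (sublattice_generated L X)"
proof (rule distributive_on_lattice_of_sets[OF _ _ R])
  have "x \<in> carrier L \<and> f x \<in> R" if "x \<in> sublattice_generated L X" for x
    using that
  proof induction
    case (join x y)
    then show ?case using lattice_of_setsD(2)[OF R(1)] by (simp add: image_join)
  next
    case (meet x y)
    then have "f x \<inter> f y \<in> R" using lattice_of_setsD(1)[OF R(1)] by blast
    with meet R(2) show ?case by (simp add: image_meet_Int subset_iff)
  qed (use X in auto)
  then show "sublattice_generated L X \<subseteq> carrier L" "f ` sublattice_generated L X \<subseteq> R" by auto
qed

lemma boolean_lattice_if_family_Icc:
  assumes family_eq: "F = {X..Y}" and "X \<subseteq> Y"
  shows "boolean_lattice L"
proof -
  obtain x y where x: "x \<in> carrier L" "f x = X" and y: "y \<in> carrier L" "f y = Y"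
    using ex_preimage[of X] ex_preimage[of Y] family_eq \<open>X \<subseteq> Y\<close> by auto
  have bounds: "X \<subseteq> f z" "f z \<subseteq> Y" if "z \<in> carrier L" for z
    using image_in_family[OF that] family_eq by auto
  have "bounded_lattice L"
  proof
    show "\<exists>b. least L b (carrier L)"
      using x bounds by (intro exI[of _ x]) (auto simp: least_def le_iff)
    show "\<exists>t. greatest L t (carrier L)"
      using y bounds by (intro exI[of _ y]) (auto simp: greatest_def le_iff)
  qed
  then interpret bounded_lattice L .
  have bot: "\<bottom> = x" and top: "\<top> = y"
    using bottom_eq[of x] top_eq[of y] x y bounds by (auto simp: le_iff)
  have "\<exists>z'\<in>carrier L. z \<sqinter> z' = \<bottom> \<and> z \<squnion> z' = \<top>" if z: "z \<in> carrier L" for z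
  proof -
    obtain z' where z': "z' \<in> carrier L" "f z' = X \<union> (Y - f z)"
      using ex_preimage[of "X \<union> (Y - f z)"] family_eq \<open>X \<subseteq> Y\<close> by auto
    have "f z \<inter> f z' = X" "f z \<union> f z' = Y"
      using z'(2) bounds[OF z] \<open>X \<subseteq> Y\<close> by auto
    then have "f (z \<sqinter> z') = f x" "f (z \<squnion> z') = f y"
      using z z'(1) family_eq \<open>X \<subseteq> Y\<close> x(2) y(2) by (simp_all add: image_join image_meet_Int)
    then have "z \<sqinter> z' = \<bottom>" "z \<squnion> z' = \<top>"
      using z z'(1) x(1) y(1) by (simp_all add: bot top flip: image_eq_iff)
    with z'(1) show ?thesis by blast
  qed
  moreover have "distributive_on L (carrier L)"
    using image_in_family family_eq
    by (intro distributive_on_lattice_of_sets[of _ F]) (auto simp: lattice_of_sets_def)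
  ultimately show ?thesis
    unfolding boolean_lattice_def using \<open>bounded_lattice L\<close> by blast
qed

lemma boolean_lattice_interval:
  assumes x: "x \<in> carrier L" and y: "y \<in> carrier L" and "f x \<subseteq> f y" and Icc: "{f x..f y} \<subseteq> F"
  shows "boolean_lattice (interval_order L x y)"
proof -
  let ?I = "interval_order L x y"
  have carrier: "carrier ?I = {z \<in> carrier L. f z \<in> {f x..f y}}"
    using x y by (auto simp: interval_order_def at_least_at_most_def le_iff)
  have "f ` carrier ?I = {f x..f y}" unfolding carrier using Icc ex_preimage by force
  then have "bij_betw f (carrier ?I) {f x..f y}"
    by (intro bij_betw_subset[OF bij]) (auto simp: carrier)
  moreover have "eq ?I = (=)" "le ?I = le L" by (simp_all add: interval_order_def eq_is_equal)
  ultimately have interval_iso: "partial_order ?I" "order_iso ?I (inclusion_order {f x..f y}) f"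
    using order_iso_inclusion_orderI[of ?I f "{f x..f y}"] by (auto simp: carrier le_iff)
  interpret interval: set_lattice ?I f "{f x..f y}"
  proof (intro set_lattice.intro set_lattice_axioms.intro interval_iso)
    fix A B assume "A \<in> {f x..f y}" "B \<in> {f x..f y}"
    then have "A \<inter> B \<in> {f x..f y}" by auto
    then show "family_interior {f x..f y} (A \<inter> B) \<in> {f x..f y}" by (simp only: family_interior_eq)
  qed auto
  show ?thesis by (rule interval.boolean_lattice_if_family_Icc[OF HOL.refl \<open>f x \<subseteq> f y\<close>])
qed

end

subsection \<open>Supersolvable antimatroids\<close>

locale armstrong_antimatroid =
  fixes E :: "'e set" and F :: "'e set set" and r :: "'e rel"
  assumes antimatroid: "supersolvable_antimatroid E F r"
begin

lemma finite_ground_set: "finite E" and linear_order: "linear_order_on E r"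
  and feasible_subset_ground_set: "F \<subseteq> Pow E" and empty_feasible: "{} \<in> F"
  using antimatroid by (auto simp: supersolvable_antimatroid_def)

lemma finite_feasible_sets: "finite F"
  using finite_ground_set feasible_subset_ground_set by (meson finite_Pow_iff finite_subset)

lemma order_refl_on: "refl_on E r" and order_trans: "trans r" and order_antisym: "antisym r"
  and order_total: "total_on E r" and order_subset: "r \<subseteq> E \<times> E"
  using linear_order by (auto simp: order_on_defs)

lemma least_element:
  assumes "S \<subseteq> E" "S \<noteq> {}"
  obtains m where "m \<in> S" "\<forall>y\<in>S. (m, y) \<in> r"
proof -
  have "finite r" using order_subset finite_ground_set finite_subset by blast
  then have "wf (r - Id)"
    using linear_order linear_order_on_well_order_on unfolding well_order_on_def by blast
  moreover obtain s where "s \<in> S" using assms(2) by blast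
  ultimately obtain m where minimal: "m \<in> S" "\<And>y. (y, m) \<in> r - Id \<Longrightarrow> y \<notin> S"
    by (rule wfE_min) blast
  have "(m, y) \<in> r" if y: "y \<in> S" for y
  proof (cases "y = m")
    case True
    with minimal(1) assms(1) show ?thesis using refl_onD[OF order_refl_on] by blast
  next
    case False
    with y minimal assms(1) order_total show ?thesis unfolding total_on_def by blast
  qed
  with minimal(1) that show thesis by blast
qed

lemma augmentation:
  assumes "A \<in> F" "B \<in> F" "x \<in> B - A" "\<forall>y\<in>B - A. (x, y) \<in> r"
  shows "insert x A \<in> F"
  using antimatroid assms unfolding supersolvable_antimatroid_def by blast

lemma augmenting_element:
  assumes A: "A \<in> F" and B: "B \<in> F" and "\<not> B \<subseteq> A"
  obtains x where "x \<in> B - A" "\<forall>y\<in>B - A. (x, y) \<in> r" "insert x A \<in> F"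
proof -
  have "B - A \<subseteq> E" "B - A \<noteq> {}" using B feasible_subset_ground_set \<open>\<not> B \<subseteq> A\<close> by auto
  then obtain x where x: "x \<in> B - A" "\<forall>y\<in>B - A. (x, y) \<in> r" by (rule least_element)
  moreover from A B x have "insert x A \<in> F" by (rule augmentation)
  ultimately show thesis by (rule that)
qed

lemma feasible_if_augmentable:
  assumes "A \<in> F" "A \<subseteq> T"
    and augment: "\<And>C. C \<in> F \<Longrightarrow> A \<subseteq> C \<Longrightarrow> C \<subset> T \<Longrightarrow> \<exists>x\<in>T - C. insert x C \<in> F"
  shows "T \<in> F"
proof -
  have "finite {C \<in> F. A \<subseteq> C \<and> C \<subseteq> T}" "{C \<in> F. A \<subseteq> C \<and> C \<subseteq> T} \<noteq> {}"
    using finite_feasible_sets assms(1,2) by auto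
  from finite_has_maximal[OF this] obtain C where C: "C \<in> F" "A \<subseteq> C" "C \<subseteq> T"
    and max: "\<And>D. D \<in> F \<Longrightarrow> A \<subseteq> D \<Longrightarrow> D \<subseteq> T \<Longrightarrow> C \<subseteq> D \<Longrightarrow> C = D"
    by auto
  have "\<not> C \<subset> T"
  proof
    assume "C \<subset> T"
    with augment C obtain x where "x \<in> T - C" "insert x C \<in> F" by blast
    with max[of "insert x C"] C(2,3) show False by blast
  qed
  with C show ?thesis by blast
qed

lemma Un_feasible:
  assumes A: "A \<in> F" and B: "B \<in> F"
  shows "A \<union> B \<in> F"
proof (rule feasible_if_augmentable[OF A])
  fix C assume C: "C \<in> F" "A \<subseteq> C" "C \<subset> A \<union> B"
  then have "\<not> B \<subseteq> C" by blast
  with C(1) B obtain x where "x \<in> B - C" "insert x C \<in> F" by (rule augmenting_element)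
  then show "\<exists>x\<in>A \<union> B - C. insert x C \<in> F" by blast
qed blast

lemma Union_feasible:
  assumes "U \<subseteq> F" shows "\<Union>U \<in> F"
  using finite_subset[OF assms finite_feasible_sets] assms
  by (induction U) (auto simp: empty_feasible Un_feasible)

lemma down_set_feasible:
  assumes B: "B \<in> F" and "D \<subseteq> B" and down: "\<And>x y. x \<in> D \<Longrightarrow> y \<in> B \<Longrightarrow> (y, x) \<in> r \<Longrightarrow> y \<in> D"
  shows "D \<in> F"
proof (rule feasible_if_augmentable[OF empty_feasible])
  fix C assume C: "C \<in> F" "C \<subset> D"
  then have "\<not> B \<subseteq> C" using \<open>D \<subseteq> B\<close> by blast
  with C(1) B obtain x
    where x: "x \<in> B - C" "\<forall>y\<in>B - C. (x, y) \<in> r" "insert x C \<in> F"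
    by (rule augmenting_element)
  obtain d where "d \<in> D - C" using C(2) by blast
  then have "x \<in> D" using x(1,2) down \<open>D \<subseteq> B\<close> by blast
  with x show "\<exists>x\<in>D - C. insert x C \<in> F" by blast
qed simp

lemma feasible_if_union_of_augmentations:
  assumes "A \<in> F" "A \<subseteq> B" "\<And>e. e \<in> B - A \<Longrightarrow> insert e A \<in> F"
  shows "B \<in> F"
proof -
  have "\<Union>(insert A ((\<lambda>e. insert e A) ` (B - A))) \<in> F" using assms by (intro Union_feasible) auto
  moreover have "\<Union>(insert A ((\<lambda>e. insert e A) ` (B - A))) = B" using assms(2) by blast
  ultimately show ?thesis by simp
qed

definition support :: "'e set" where
  "support = \<Union>F"

lemma support_feasible: "support \<in> F"
  unfolding support_def by (rule Union_feasible) simp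

lemma feasible_subset_support: "A \<in> F \<Longrightarrow> A \<subseteq> support"
  by (auto simp: support_def)

lemma support_subset: "support \<subseteq> E"
  using support_feasible feasible_subset_ground_set by blast

definition initial_segments :: "'e set set" where
  "initial_segments = {D. D \<subseteq> support \<and> (\<forall>x\<in>D. \<forall>y\<in>support. (y, x) \<in> r \<longrightarrow> y \<in> D)}"

lemma support_initial_segment: "support \<in> initial_segments"
  by (simp add: initial_segments_def)

lemma principal_initial_segment: "{z \<in> support. (z, y) \<in> r} \<in> initial_segments"
proof -
  have "(w, y) \<in> r" if "(w, z) \<in> r" "(z, y) \<in> r" for w z
    using order_trans that by (rule transD)
  then show ?thesis unfolding initial_segments_def by blast
qed

lemma initial_segment_Int_feasible:
  assumes "D \<in> initial_segments" "B \<in> F"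
  shows "D \<inter> B \<in> F"
proof (rule down_set_feasible[OF assms(2)])
  fix x y assume "x \<in> D \<inter> B" "y \<in> B" "(y, x) \<in> r"
  then show "y \<in> D \<inter> B"
    using assms feasible_subset_support[OF assms(2)] unfolding initial_segments_def by blast
qed simp

lemma initial_segments_feasible: "initial_segments \<subseteq> F"
proof
  fix D assume D: "D \<in> initial_segments"
  then have "D \<inter> support = D" by (auto simp: initial_segments_def)
  with initial_segment_Int_feasible[OF D support_feasible] show "D \<in> F" by simp
qed

lemma chain_initial_segments: "chain\<^sub>\<subseteq> initial_segments"
proof -
  have "D' \<subseteq> D"
    if D: "D \<in> initial_segments" "D' \<in> initial_segments" and x: "x \<in> D" "x \<notin> D'" for D D' x
  proof
    fix y assume y: "y \<in> D'"
    with D x have "x \<in> support" "y \<in> support" "(x, y) \<notin> r" unfolding initial_segments_def by blast+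
    moreover have "x \<noteq> y" using x(2) y by blast
    ultimately have "(y, x) \<in> r" using support_subset order_total unfolding total_on_def by blast
    with D(1) x(1) \<open>y \<in> support\<close> show "y \<in> D" unfolding initial_segments_def by blast
  qed
  then show ?thesis unfolding chain_subset_def by blast
qed

text \<open>
  If \<open>x \<in> Z\<close> and \<open>y \<notin> Z\<close> is below \<open>x\<close>, then \<open>Z\<close> lies inside the segment of all elements below \<open>y\<close>,
  so that \<open>x\<close> is also below \<open>y\<close>.
\<close>

lemma initial_segment_if_comparable:
  assumes "Z \<subseteq> support" and comparable: "\<And>D. D \<in> initial_segments \<Longrightarrow> D \<subseteq> Z \<or> Z \<subseteq> D"
  shows "Z \<in> initial_segments"
  unfolding initial_segments_def mem_Collect_eq
proof (intro conjI ballI impI \<open>Z \<subseteq> support\<close>, rule ccontr)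
  fix x y assume x: "x \<in> Z" and y: "y \<in> support" "(y, x) \<in> r" "y \<notin> Z"
  then have "(y, y) \<in> r" using support_subset refl_onD[OF order_refl_on] by blast
  then have "Z \<subseteq> {z \<in> support. (z, y) \<in> r}"
    using comparable[OF principal_initial_segment, of y] y by blast
  then have "(x, y) \<in> r" using x by blast
  with y x antisymD[OF order_antisym] show False by blast
qed

end

subsection \<open>The lattice of feasible sets\<close>

locale antimatroid_lattice = armstrong_antimatroid E F r + partial_order L
  for E :: "'e set" and F r and L :: "('a, 'c) gorder_scheme" (structure) +
  fixes f :: "'a \<Rightarrow> 'e set"
  assumes iso: "order_iso L (inclusion_order F) f"
begin

sublocale set_lattice L f F
  by unfold_locales (auto simp: iso Un_feasible family_interior_def intro: Union_feasible)

lemma finite_lattice: "finite_lattice L"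
proof -
  have "finite (carrier L)" using bij finite_feasible_sets bij_betw_finite by blast
  moreover have "carrier L \<noteq> {}" using ex_preimage[OF empty_feasible] by blast
  ultimately show ?thesis by (simp add: finite_lattice_def lattice_axioms)
qed

lemma covered_by_iff_insert:
  assumes x: "x \<in> carrier L" and y: "y \<in> carrier L"
  shows "covered_by L x y \<longleftrightarrow> (\<exists>e. e \<notin> f x \<and> f y = insert e (f x))"
proof
  assume cov: "covered_by L x y"
  then have "x \<sqsubset> y" by (simp add: covered_by_def)
  then have less: "f x \<subset> f y" unfolding lless_iff[OF x y] .
  then have "\<not> f y \<subseteq> f x" by blast
  from augmenting_element[OF image_in_family[OF x] image_in_family[OF y] this]
  obtain e where e: "e \<in> f y - f x" "insert e (f x) \<in> F" by blast
  obtain z where z: "z \<in> carrier L" "f z = insert e (f x)" using ex_preimage[OF e(2)] by blast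
  then have "x \<sqsubset> z" unfolding lless_iff[OF x z(1)] using e(1) by blast
  then have "\<not> z \<sqsubset> y" using cov z(1) by (simp add: covered_by_def)
  then have "\<not> insert e (f x) \<subset> f y" unfolding lless_iff[OF z(1) y] z(2) .
  then have "f y = insert e (f x)" using e(1) less by blast
  with e(1) show "\<exists>e. e \<notin> f x \<and> f y = insert e (f x)" by blast
next
  assume "\<exists>e. e \<notin> f x \<and> f y = insert e (f x)"
  then obtain e where e: "e \<notin> f x" "f y = insert e (f x)" by blast
  then have "x \<sqsubset> y" unfolding lless_iff[OF x y] by blast
  moreover have "\<not> (x \<sqsubset> z \<and> z \<sqsubset> y)" if z: "z \<in> carrier L" for z
    unfolding lless_iff[OF x z] lless_iff[OF z y] e(2) by blast
  ultimately show "covered_by L x y" using x y by (simp add: covered_by_def)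
qed

lemma semimodular: "semimodular L"
  unfolding semimodular_def
proof (intro ballI impI)
  fix x y assume x: "x \<in> carrier L" and y: "y \<in> carrier L" and cov: "covered_by L (x \<sqinter> y) x"
  have meet_carrier: "x \<sqinter> y \<in> carrier L" using x y by simp
  obtain e where e: "e \<notin> f (x \<sqinter> y)" "f x = insert e (f (x \<sqinter> y))"
    using cov x meet_carrier by (auto simp: covered_by_iff_insert)
  have meet_subset: "f (x \<sqinter> y) \<subseteq> f y"
    using family_interior_subset[of F "f x \<inter> f y"] x y by (simp add: image_meet)
  have "e \<notin> f y"
  proof
    assume "e \<in> f y"
    then have "f x \<subseteq> f y" using meet_subset by (simp add: e(2))
    then have "f (x \<sqinter> y) = f x" using x y image_in_family by (simp add: image_meet_Int Int_absorb2)
    with e show False by blast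
  qed
  moreover have "f (x \<squnion> y) = insert e (f y)" using x y e(2) meet_subset by (auto simp: image_join)
  ultimately show "covered_by L y (x \<squnion> y)" using x y by (auto simp: covered_by_iff_insert)
qed

lemma augmentable_if_join_of_covers:
  assumes x: "x \<in> carrier L" and y: "y \<in> carrier L" and "x \<sqsubseteq> y"
    and lub: "is_lub (interval_order L x y) y {z \<in> \<lbrace>x..y\<rbrace>. covered_by L x z}"
    and e: "e \<in> f y - f x"
  shows "insert e (f x) \<in> F"
proof -
  define T where "T = {e \<in> f y. insert e (f x) \<in> F}"
  have "f x \<subseteq> f y" using x y \<open>x \<sqsubseteq> y\<close> by (simp add: le_iff)
  then have T_between: "f x \<subseteq> T" "T \<subseteq> f y"
    using image_in_family[OF x] by (auto simp: T_def insert_absorb)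
  have "T \<in> F"
    by (rule feasible_if_union_of_augmentations[OF image_in_family[OF x] T_between(1)])
      (simp add: T_def)
  then obtain u where u: "u \<in> carrier L" "f u = T" using ex_preimage by blast
  have "u \<in> \<lbrace>x..y\<rbrace>"
    using x y u T_between by (simp add: at_least_at_most_def le_iff)
  moreover have "z \<sqsubseteq> u" if z: "z \<in> \<lbrace>x..y\<rbrace>" "covered_by L x z" for z
  proof -
    have z_carrier: "z \<in> carrier L" and "f z \<subseteq> f y"
      using z(1) y by (auto simp: at_least_at_most_def le_iff)
    obtain e where e: "f z = insert e (f x)"
      using z(2) unfolding covered_by_iff_insert[OF x z_carrier] by blast
    then have "insert e (f x) \<in> F" "e \<in> f y"
      using image_in_family[OF z_carrier] \<open>f z \<subseteq> f y\<close> by simp_all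
    then have "f z \<subseteq> T" using T_between(1) unfolding e by (simp add: T_def)
    with z_carrier u show ?thesis by (simp add: le_iff)
  qed
  ultimately have "y \<sqsubseteq> u"
    using lub by (auto simp: least_def Upper_def interval_order_def)
  then have "f y \<subseteq> T" using y u by (simp add: le_iff)
  with e show ?thesis by (auto simp: T_def)
qed

lemma join_distributive: "join_distributive_lattice L"
  unfolding join_distributive_lattice_def
proof (intro conjI ballI impI finite_lattice semimodular)
  fix x y assume x: "x \<in> carrier L" and y: "y \<in> carrier L" and "x \<sqsubseteq> y"
    and "is_lub (interval_order L x y) y {z \<in> \<lbrace>x..y\<rbrace>. covered_by L x z}"
  then have "insert e (f x) \<in> F" if "e \<in> f y - f x" for e
    using that by (rule augmentable_if_join_of_covers)
  then have "A \<in> F" if "f x \<subseteq> A" "A \<subseteq> f y" for A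
    using feasible_if_union_of_augmentations[OF image_in_family[OF x] that(1)] that(2) by blast
  then have "{f x..f y} \<subseteq> F" by auto
  moreover have "f x \<subseteq> f y" using x y \<open>x \<sqsubseteq> y\<close> by (simp add: le_iff)
  ultimately show "boolean_lattice (interval_order L x y)"
    using x y by (intro boolean_lattice_interval)
qed

definition segment_chain :: "'a set" where
  "segment_chain = {x \<in> carrier L. f x \<in> initial_segments}"

lemma maximal_segment_chain: "maximal_chain L segment_chain"
  unfolding maximal_chain_def
proof (intro conjI allI impI)
  show "chain_in L segment_chain"
    using chain_initial_segments
    by (auto simp: chain_in_def segment_chain_def chain_subset_def le_iff)
  fix C assume C: "chain_in L C \<and> segment_chain \<subseteq> C"
  have "c \<in> segment_chain" if c: "c \<in> C" for c
  proof -
    have c_carrier: "c \<in> carrier L" using C c by (auto simp: chain_in_def)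
    have "D \<subseteq> f c \<or> f c \<subseteq> D" if D: "D \<in> initial_segments" for D
    proof -
      obtain d where d: "d \<in> carrier L" "f d = D"
        using D initial_segments_feasible ex_preimage by blast
      with D C have "d \<in> C" by (auto simp: segment_chain_def)
      with C c have "d \<sqsubseteq> c \<or> c \<sqsubseteq> d" by (auto simp: chain_in_def)
      with d c_carrier show ?thesis by (simp add: le_iff)
    qed
    with feasible_subset_support[OF image_in_family[OF c_carrier]] have "f c \<in> initial_segments"
      by (rule initial_segment_if_comparable)
    with c_carrier show ?thesis by (simp add: segment_chain_def)
  qed
  with C show "C = segment_chain" by blast
qed

lemma distributive_on_segment_chain_Un_chain:
  assumes C: "chain_in L C"
  shows "distributive_on L (sublattice_generated L (segment_chain \<union> C))"
proof -
  define \<D> where "\<D> = insert support (f ` C)"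
  define R where "R = Union ` Pow {D \<inter> Z |D Z. D \<in> initial_segments \<and> Z \<in> \<D>}"
  have C_carrier: "C \<subseteq> carrier L" using C by (simp add: chain_in_def)
  have chain_feasible: "\<D> \<subseteq> F"
    using C_carrier image_in_family support_feasible by (auto simp: \<D>_def)
  have "f c \<subseteq> f d \<or> f d \<subseteq> f c" if "c \<in> C" "d \<in> C" for c d
    using C that C_carrier le_iff[of c d] le_iff[of d c] unfolding chain_in_def by blast
  then have "chain\<^sub>\<subseteq> \<D>"
    using chain_feasible feasible_subset_support unfolding chain_subset_def \<D>_def by blast
  then have "lattice_of_sets R"
    unfolding R_def using chain_initial_segments by (intro lattice_of_sets_two_chains)
  moreover have "{D \<inter> Z |D Z. D \<in> initial_segments \<and> Z \<in> \<D>} \<subseteq> F"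
    using chain_feasible initial_segment_Int_feasible by blast
  then have "R \<subseteq> F" unfolding R_def by (intro image_subsetI Union_feasible) blast
  moreover have Int_in_R: "D \<inter> Z \<in> R" if "D \<in> initial_segments" "Z \<in> \<D>" for D Z
    unfolding R_def using that by (intro image_eqI[of _ _ "{D \<inter> Z}"]) auto
  have "f x \<in> R" if "x \<in> segment_chain \<union> C" for x
  proof -
    from that C_carrier have "f x \<inter> support = f x" "support \<inter> f x = f x"
      using feasible_subset_support[OF image_in_family] by (auto simp: segment_chain_def)
    with that Int_in_R[of "f x" support] Int_in_R[OF support_initial_segment, of "f x"] show ?thesis
      by (auto simp: segment_chain_def \<D>_def)
  qed
  moreover have "segment_chain \<union> C \<subseteq> carrier L" using C_carrier by (auto simp: segment_chain_def)
  ultimately show ?thesis by (intro distributive_on_sublattice_generated) auto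
qed

lemma supersolvable: "supersolvable_lattice L"
  unfolding supersolvable_lattice_def
  using finite_lattice maximal_segment_chain distributive_on_segment_chain_Un_chain by blast

end

subsection \<open>Words in reflections\<close>

lemma word_prod_simps [simp]:
  "word_prod [] = id" "word_prod (s # ss) = s \<circ> word_prod ss"
  by (simp_all add: word_prod_def)

lemma word_prod_append: "word_prod (ss @ ts) = word_prod ss \<circ> word_prod ts"
  by (induction ss) (simp_all add: comp_assoc)

lemma bij_word_prod: "(\<And>s. s \<in> set ss \<Longrightarrow> bij s) \<Longrightarrow> bij (word_prod ss)"
  by (induction ss) (simp_all add: bij_comp)

lemma bij_involution: "s \<circ> s = id \<Longrightarrow> bij s"
  by (rule o_bij)

lemma BijGroup_UNIV_one: "\<one>\<^bsub>BijGroup UNIV\<^esub> = id"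
  by (simp add: BijGroup_def fun_eq_iff)

lemma BijGroup_UNIV_mult: "bij g \<Longrightarrow> bij h \<Longrightarrow> g \<otimes>\<^bsub>BijGroup UNIV\<^esub> h = g \<circ> h"
  by (simp add: BijGroup_def Bij_def compose_def fun_eq_iff)

lemma BijGroup_UNIV_inv_involution:
  assumes "s \<circ> s = id" shows "inv\<^bsub>BijGroup UNIV\<^esub> s = s"
proof (rule group.inv_equality[OF group_BijGroup])
  have "bij s" using assms by (rule bij_involution)
  then show "s \<in> carrier (BijGroup UNIV)" "s \<in> carrier (BijGroup UNIV)"
    by (simp_all add: BijGroup_def Bij_def)
  show "s \<otimes>\<^bsub>BijGroup UNIV\<^esub> s = \<one>\<^bsub>BijGroup UNIV\<^esub>"
    by (simp only: BijGroup_UNIV_mult[OF \<open>bij s\<close> \<open>bij s\<close>] BijGroup_UNIV_one assms)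
qed

lemma generate_involutions:
  assumes involution: "\<And>s. s \<in> S \<Longrightarrow> s \<circ> s = id"
  shows "generate (BijGroup UNIV) S = word_prod ` lists S"
proof -
  have bij: "bij s" if "s \<in> S" for s using involution[OF that] by (rule bij_involution)
  have bij_word: "bij (word_prod ss)" if "ss \<in> lists S" for ss
    using that bij by (intro bij_word_prod) auto
  have singleton: "s \<in> word_prod ` lists S" if "s \<in> S" for s
    using that by (intro image_eqI[of _ _ "[s]"]) simp_all
  have "g \<in> word_prod ` lists S" if "g \<in> generate (BijGroup UNIV) S" for g
    using that
  proof induction
    case one
    show ?case unfolding BijGroup_UNIV_one by (intro image_eqI[of _ _ "[]"]) simp_all
  next
    case (incl s)
    then show ?case by (rule singleton)
  next
    case (inv s)
    then show ?case by (simp add: BijGroup_UNIV_inv_involution involution singleton)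
  next
    case (eng g h)
    then obtain ss ts where "ss \<in> lists S" "g = word_prod ss" "ts \<in> lists S" "h = word_prod ts"
      by blast
    then show ?case
      by (intro image_eqI[of _ _ "ss @ ts"])
        (simp_all add: BijGroup_UNIV_mult bij_word word_prod_append)
  qed
  moreover have "word_prod ss \<in> generate (BijGroup UNIV) S" if "ss \<in> lists S" for ss
    using that
  proof induction
    case Nil
    show ?case unfolding word_prod_simps BijGroup_UNIV_one[symmetric] by (rule generate.one)
  next
    case (Cons s ss)
    then have "s \<otimes>\<^bsub>BijGroup UNIV\<^esub> word_prod ss \<in> generate (BijGroup UNIV) S"
      by (intro generate.eng[OF generate.incl])
    with Cons.hyps show ?case by (simp only: BijGroup_UNIV_mult bij bij_word word_prod_simps)
  qed
  ultimately show ?thesis by blast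
qed

lemma linear_root_reflection: "linear (root_reflection a)"
  unfolding root_reflection_def
  by (rule linearI) (simp_all add: algebra_simps inner_add_left add_divide_distrib scaleR_add_left)

lemma root_reflection_root_reflection [simp]: "root_reflection a (root_reflection a x) = x"
  by (cases "a = 0") (simp_all add: root_reflection_def algebra_simps inner_diff_left)

lemma root_reflection_comp_self [simp]: "root_reflection a \<circ> root_reflection a = id"
  by (simp add: fun_eq_iff)

lemma inner_root_reflection: "root_reflection a x \<bullet> y = x \<bullet> root_reflection a y"
  by (simp add: root_reflection_def inner_diff_left inner_diff_right inner_commute)

lemma root_reflection_uminus [simp]: "root_reflection (- a) = root_reflection a"
  by (simp add: root_reflection_def)

lemma root_reflection_self: "a \<noteq> 0 \<Longrightarrow> root_reflection a a = - a"
  by (simp add: root_reflection_def scaleR_2)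

lemma root_reflection_orthogonal: "x \<bullet> a = 0 \<Longrightarrow> root_reflection a x = x"
  by (simp add: root_reflection_def)

lemma root_reflection_conjugate:
  "root_reflection (root_reflection a b) =
    root_reflection a \<circ> root_reflection b \<circ> root_reflection a"
proof
  fix x
  have norm: "root_reflection a b \<bullet> root_reflection a b = b \<bullet> b"
    by (simp add: inner_root_reflection)
  have "(root_reflection a \<circ> root_reflection b \<circ> root_reflection a) x =
      root_reflection a (root_reflection a x - (2 * (root_reflection a x \<bullet> b) / (b \<bullet> b)) *\<^sub>R b)"
    by (simp add: root_reflection_def[of b])
  also have "\<dots> = x - (2 * (root_reflection a x \<bullet> b) / (b \<bullet> b)) *\<^sub>R root_reflection a b"
    by (simp add: linear_diff linear_scale linear_root_reflection)
  also have "\<dots> = root_reflection (root_reflection a b) x"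
    by (simp only: root_reflection_def[of "root_reflection a b"] norm
        inner_root_reflection[of a x b])
  finally show "root_reflection (root_reflection a b) x =
      (root_reflection a \<circ> root_reflection b \<circ> root_reflection a) x" by simp
qed

lemma root_reflection_commute:
  assumes "a \<bullet> b = 0"
  shows "root_reflection a (root_reflection b x) = root_reflection b (root_reflection a x)"
  using assms by (simp add: root_reflection_def inner_diff_left inner_commute algebra_simps)

definition reflection_word :: "'a::euclidean_space list \<Rightarrow> 'a \<Rightarrow> 'a" where
  "reflection_word as = word_prod (map root_reflection as)"

lemma reflection_word_simps [simp]:
  "reflection_word [] = id"
  "reflection_word (a # as) = root_reflection a \<circ> reflection_word as"
  "reflection_word (as @ bs) = reflection_word as \<circ> reflection_word bs"
  by (simp_all add: reflection_word_def word_prod_append)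

lemma word_prod_reflections: "word_prod ` lists (root_reflection ` J) = reflection_word ` lists J"
  by (simp add: lists_image image_image reflection_word_def)

lemma generate_reflections:
  "generate (BijGroup UNIV) (root_reflection ` J) = reflection_word ` lists J"
  by (subst generate_involutions) (auto simp: word_prod_reflections)

lemma linear_reflection_word: "linear (reflection_word as)"
proof (induction as)
  case Nil
  show ?case by (simp add: id_def linear_ident)
next
  case (Cons a as)
  then show ?case unfolding reflection_word_simps by (intro linear_compose linear_root_reflection)
qed

lemma reflection_word_rev [simp]:
  "reflection_word (rev as) (reflection_word as x) = x"
  "reflection_word as (reflection_word (rev as) x) = x"
  by (induction as arbitrary: x) simp_all

lemma root_reflection_word_conjugate:
  "root_reflection (reflection_word as b) =
    reflection_word as \<circ> root_reflection b \<circ> reflection_word (rev as)"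
  by (induction as) (simp_all add: root_reflection_conjugate comp_assoc)

lemma reflection_word_commute:
  assumes "\<forall>c\<in>set as. b \<bullet> c = 0"
  shows "reflection_word as (root_reflection b x) = root_reflection b (reflection_word as x)"
  using assms by (induction as) (simp_all add: root_reflection_commute)

lemma reflection_word_fixes:
  assumes "\<forall>a\<in>set as. x \<bullet> a = 0"
  shows "reflection_word as x = x"
  using assms by (induction as) (simp_all add: root_reflection_orthogonal)

lemma reflection_word_diff_span: "reflection_word as x - x \<in> span (set as)"
proof (induction as)
  case (Cons a as)
  have "reflection_word as x - x \<in> span (set (a # as))"
    using Cons span_mono[of "set as" "set (a # as)"] by auto
  then have "(reflection_word as x - x) - (2 * (reflection_word as x \<bullet> a) / (a \<bullet> a)) *\<^sub>R a
      \<in> span (set (a # as))"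
    by (rule span_diff) (simp add: span_scale span_base)
  then show ?case by (simp add: root_reflection_def algebra_simps)
qed (simp add: span_zero)

subsection \<open>Root systems with a base\<close>

lemma ex_prescribed_inner:
  fixes B :: "'a::euclidean_space set"
  assumes "independent B"
  shows "\<exists>x. \<forall>b\<in>B. x \<bullet> b = g b"
proof -
  obtain f :: "'a \<Rightarrow> real" where extension: "linear f" "\<forall>b\<in>B. f b = g b"
    using linear_independent_extend[OF assms, of g] by blast
  have "adjoint f 1 \<bullet> b = f b" for b
    using adjoint_works[OF extension(1), of b 1] by (simp add: inner_commute)
  with extension(2) show ?thesis by metis
qed

locale based_root_system =
  fixes \<Phi> \<Delta> :: "'a::euclidean_space set"
  assumes root_system: "root_system \<Phi>" and root_base: "root_base \<Phi> \<Delta>"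
begin

abbreviation pos :: "'a set" where
  "pos \<equiv> positive_roots \<Phi> \<Delta>"

abbreviation coeff :: "'a \<Rightarrow> 'a \<Rightarrow> real" where
  "coeff \<equiv> representation \<Delta>"

lemma finite_roots: "finite \<Phi>"
  and root_nonzero: "a \<in> \<Phi> \<Longrightarrow> a \<noteq> 0"
  and root_reflection_root: "a \<in> \<Phi> \<Longrightarrow> b \<in> \<Phi> \<Longrightarrow> root_reflection a b \<in> \<Phi>"
  and root_multiple: "a \<in> \<Phi> \<Longrightarrow> c *\<^sub>R a \<in> \<Phi> \<Longrightarrow> c = 1 \<or> c = - 1"
  using root_system by (auto simp: root_system_def)

lemma base_subset: "\<Delta> \<subseteq> \<Phi>"
  and independent_base: "independent \<Delta>"
  and positive_or_negative: "b \<in> \<Phi> \<Longrightarrow> b \<in> pos \<or> - b \<in> pos"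
  using root_base by (auto simp: root_base_def)

lemma finite_base: "finite \<Delta>"
  using base_subset finite_roots by (rule finite_subset)

lemma base_inner_self: "a \<in> \<Delta> \<Longrightarrow> 0 < a \<bullet> a"
  using base_subset root_nonzero by auto

lemma reflection_word_root:
  assumes "set as \<subseteq> \<Phi>" "b \<in> \<Phi>" shows "reflection_word as b \<in> \<Phi>"
  using assms by (induction as) (simp_all add: root_reflection_root)

lemma positive_root: "b \<in> pos \<Longrightarrow> b \<in> \<Phi>"
  by (simp add: positive_roots_def)

lemma positive_root_span: "b \<in> pos \<Longrightarrow> b \<in> span \<Delta>"
  by (auto simp: positive_roots_def intro: span_sum span_scale span_base)

lemma root_span:
  assumes "b \<in> \<Phi>" shows "b \<in> span \<Delta>"
  using positive_or_negative[OF assms] positive_root_span[of b] positive_root_span[of "- b"]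
    span_neg[of "- b" \<Delta>] by auto

lemma base_expansion: "v \<in> span \<Delta> \<Longrightarrow> (\<Sum>a\<in>\<Delta>. coeff v a *\<^sub>R a) = v"
  by (rule real_vector.sum_representation_eq) (simp_all add: independent_base finite_base)

lemma coeff_base: "a \<in> \<Delta> \<Longrightarrow> coeff a b = (if b = a then 1 else 0)"
  by (simp add: real_vector.representation_basis independent_base)

lemma coeff_add_base:
  assumes "v \<in> span \<Delta>" "a \<in> \<Delta>"
  shows "coeff (v + k *\<^sub>R a) b = coeff v b + (if b = a then k else 0)"
  using assms
  by (simp add: real_vector.representation_add real_vector.representation_scale independent_base
      span_base span_scale coeff_base)

lemma coeff_uminus: "v \<in> span \<Delta> \<Longrightarrow> coeff (- v) a = - coeff v a"
  by (simp add: real_vector.representation_neg independent_base)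

lemma coeff_root_reflection:
  assumes "v \<in> span \<Delta>" "a \<in> \<Delta>"
  shows "coeff (root_reflection a v) b = coeff v b - (if b = a then 2 * (v \<bullet> a) / (a \<bullet> a) else 0)"
  using coeff_add_base[OF assms, of "- (2 * (v \<bullet> a) / (a \<bullet> a))" b]
  by (simp add: root_reflection_def)

lemma positive_coeff_ge_0:
  assumes "b \<in> pos" "a \<in> \<Delta>" shows "0 \<le> coeff b a"
proof -
  obtain n :: "'a \<Rightarrow> nat" where "b = (\<Sum>a\<in>\<Delta>. real (n a) *\<^sub>R a)"
    using assms(1) by (auto simp: positive_roots_def)
  then have "coeff b a = (\<Sum>c\<in>\<Delta>. coeff (real (n c) *\<^sub>R c) a)"
    by (simp add: real_vector.representation_sum independent_base span_base span_scale)
  also have "\<dots> \<ge> 0"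
    by (intro sum_nonneg)
      (simp add: real_vector.representation_scale independent_base span_base coeff_base)
  finally show ?thesis .
qed

lemma positive_if_coeff_positive:
  assumes "b \<in> \<Phi>" "a \<in> \<Delta>" "0 < coeff b a" shows "b \<in> pos"
  using positive_or_negative[OF assms(1)] positive_coeff_ge_0[of "- b" a] assms
  by (auto simp: coeff_uminus root_span)

lemma ex_coeff_positive:
  assumes "b \<in> pos" obtains a where "a \<in> \<Delta>" "0 < coeff b a"
proof -
  have "\<exists>a\<in>\<Delta>. coeff b a \<noteq> 0"
  proof (rule ccontr)
    assume "\<not> ?thesis"
    then have "b = 0" using base_expansion[OF positive_root_span[OF assms]] by simp
    with assms show False using positive_root root_nonzero by blast
  qed
  with assms positive_coeff_ge_0 that show thesis by (metis order_le_less)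
qed

lemma uminus_not_positive:
  assumes "b \<in> pos" shows "- b \<notin> pos"
proof
  assume neg: "- b \<in> pos"
  obtain a where "a \<in> \<Delta>" "0 < coeff b a" using assms by (rule ex_coeff_positive)
  with positive_coeff_ge_0[OF neg] positive_root_span[OF assms] show False
    by (force simp: coeff_uminus)
qed

lemma base_positive: "a \<in> \<Delta> \<Longrightarrow> a \<in> pos"
  using base_subset by (intro positive_if_coeff_positive[of a a]) (auto simp: coeff_base)

lemma simple_reflection_positive:
  assumes a: "a \<in> \<Delta>" and b: "b \<in> pos" and "b \<noteq> a"
  shows "root_reflection a b \<in> pos"
proof -
  have "\<exists>c\<in>\<Delta>. c \<noteq> a \<and> 0 < coeff b c"
  proof (rule ccontr)
    assume "\<not> ?thesis"
    then have "coeff b c = 0" if "c \<in> \<Delta> - {a}" for c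
      using that positive_coeff_ge_0[OF b, of c] by force
    then have multiple: "b = coeff b a *\<^sub>R a"
      using base_expansion[OF positive_root_span[OF b]] by (simp add: sum.remove[OF finite_base a])
    then have "coeff b a = 1 \<or> coeff b a = - 1"
      using root_multiple[of a "coeff b a"] a base_subset positive_root[OF b] by auto
    with multiple \<open>b \<noteq> a\<close> positive_coeff_ge_0[OF b a] show False by force
  qed
  then obtain c where other_coeff: "c \<in> \<Delta>" "c \<noteq> a" "0 < coeff b c" by blast
  then have "0 < coeff (root_reflection a b) c"
    using a positive_root_span[OF b] by (simp add: coeff_root_reflection)
  moreover have "root_reflection a b \<in> \<Phi>"
    using a base_subset positive_root[OF b] by (intro root_reflection_root) auto
  ultimately show ?thesis using other_coeff(1) by (intro positive_if_coeff_positive)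
qed

lemma base_obtuse:
  assumes a: "a \<in> \<Delta>" and b: "b \<in> \<Delta>" and "a \<noteq> b" shows "a \<bullet> b \<le> 0"
proof -
  have "root_reflection a b \<in> pos"
    using simple_reflection_positive[OF a base_positive[OF b]] \<open>a \<noteq> b\<close> by simp
  then have "0 \<le> coeff (root_reflection a b) a" using a by (rule positive_coeff_ge_0)
  also have "\<dots> = - (2 * (b \<bullet> a) / (a \<bullet> a))"
    using a b \<open>a \<noteq> b\<close> by (simp add: coeff_root_reflection coeff_base span_base)
  finally show ?thesis using base_inner_self[OF a] by (simp add: inner_commute divide_le_0_iff)
qed

definition height :: "'a \<Rightarrow> real" where
  "height v = (\<Sum>a\<in>\<Delta>. coeff v a)"

lemma height_root_reflection:
  assumes "v \<in> span \<Delta>" "a \<in> \<Delta>"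
  shows "height (root_reflection a v) = height v - 2 * (v \<bullet> a) / (a \<bullet> a)"
  using assms finite_base by (simp add: height_def coeff_root_reflection sum_subtractf)

lemma positive_root_descent:
  assumes b: "b \<in> pos" and "b \<notin> \<Delta>"
  obtains a where "a \<in> \<Delta>" "root_reflection a b \<in> pos" "height (root_reflection a b) < height b"
proof -
  have "b \<bullet> b = (\<Sum>a\<in>\<Delta>. coeff b a * (b \<bullet> a))"
    by (subst (2) base_expansion[OF positive_root_span[OF b], symmetric])
      (simp add: inner_sum_right)
  moreover have "b \<bullet> b > 0" using root_nonzero[OF positive_root[OF b]] by simp
  ultimately obtain a where positive_term: "a \<in> \<Delta>" "coeff b a * (b \<bullet> a) > 0"
    using sum_nonpos[of \<Delta> "\<lambda>a. coeff b a * (b \<bullet> a)"] by force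
  then have "b \<bullet> a > 0"
    using positive_coeff_ge_0[OF b positive_term(1)] by (auto simp: zero_less_mult_iff)
  then have "height (root_reflection a b) < height b"
    using positive_term(1) base_inner_self[OF positive_term(1)] positive_root_span[OF b]
    by (simp add: height_root_reflection)
  moreover have "root_reflection a b \<in> pos"
    using simple_reflection_positive[OF positive_term(1) b] positive_term(1) \<open>b \<notin> \<Delta>\<close> by blast
  ultimately show thesis using positive_term(1) by (intro that)
qed

lemma positive_root_conjugate_simple:
  assumes "b \<in> pos"
  shows "\<exists>as\<in>lists \<Delta>. \<exists>a\<in>\<Delta>. b = reflection_word as a"
proof (rule ccontr)
  define bad where "bad = {b \<in> pos. \<not> (\<exists>as\<in>lists \<Delta>. \<exists>a\<in>\<Delta>. b = reflection_word as a)}"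
  assume "\<not> ?thesis"
  then have "bad \<noteq> {}" using assms by (auto simp: bad_def)
  moreover have "finite bad" using finite_roots by (simp add: bad_def positive_roots_def)
  ultimately obtain c where c_bad: "c \<in> bad" and minimal: "\<And>d. d \<in> bad \<Longrightarrow> height c \<le> height d"
    using ex_is_arg_min_if_finite[of bad height] by (auto simp: is_arg_min_linorder)
  have "c \<notin> \<Delta>"
  proof
    assume "c \<in> \<Delta>"
    then have "\<exists>a\<in>\<Delta>. c = reflection_word [] a" by simp
    with c_bad show False unfolding bad_def by blast
  qed
  then obtain a where a: "a \<in> \<Delta>" and descent: "root_reflection a c \<in> pos"
    "height (root_reflection a c) < height c"
    using c_bad positive_root_descent unfolding bad_def by blast
  then have "root_reflection a c \<notin> bad" using minimal by force
  then obtain as d where conjugate: "as \<in> lists \<Delta>" "d \<in> \<Delta>"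
    "root_reflection a c = reflection_word as d"
    using descent(1) unfolding bad_def by blast
  then have "c = reflection_word (a # as) d"
    by (metis comp_apply reflection_word_simps(2) root_reflection_root_reflection)
  moreover have "a # as \<in> lists \<Delta>" using a conjugate(1) by simp
  ultimately show False using c_bad conjugate(2) unfolding bad_def by blast
qed

subsection \<open>Length and Bruhat order\<close>

lemma root_reflection_simple_word:
  assumes "b \<in> \<Phi>" shows "root_reflection b \<in> reflection_word ` lists \<Delta>"
proof -
  have word: "root_reflection c \<in> reflection_word ` lists \<Delta>" if c: "c \<in> pos" for c
  proof -
    obtain as a where conjugate: "as \<in> lists \<Delta>" "a \<in> \<Delta>" "c = reflection_word as a"
      using positive_root_conjugate_simple[OF c] by blast
    have "root_reflection c = reflection_word (as @ a # rev as)"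
      unfolding conjugate(3) root_reflection_word_conjugate by (simp add: comp_assoc)
    moreover have "as @ a # rev as \<in> lists \<Delta>" using conjugate(1,2) by auto
    ultimately show ?thesis by blast
  qed
  from positive_or_negative[OF assms] word[of b] word[of "- b"] show ?thesis by auto
qed

lemma weyl_group_words: "weyl_group \<Phi> = reflection_word ` lists \<Delta>"
proof
  have "reflection_word as \<in> reflection_word ` lists \<Delta>" if "as \<in> lists \<Phi>" for as
    using that
  proof induction
    case Nil
    show ?case by blast
  next
    case (Cons a as)
    then obtain bs cs where "bs \<in> lists \<Delta>" "root_reflection a = reflection_word bs"
      and "cs \<in> lists \<Delta>" "reflection_word as = reflection_word cs"
      using root_reflection_simple_word by blast
    then show ?case by (intro image_eqI[of _ _ "bs @ cs"]) simp_all
  qed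
  then show "weyl_group \<Phi> \<subseteq> reflection_word ` lists \<Delta>"
    unfolding weyl_group_def generate_reflections by blast
  show "reflection_word ` lists \<Delta> \<subseteq> weyl_group \<Phi>"
    unfolding weyl_group_def generate_reflections using base_subset by (intro image_mono lists_mono)
qed

lemma weyl_length_le:
  assumes "set as \<subseteq> \<Delta>"
  shows "weyl_length \<Delta> (reflection_word as) \<le> length as"
  unfolding weyl_length_def using assms
  by (intro Least_le exI[of _ "map root_reflection as"]) (auto simp: reflection_word_def)

lemma reduced_word:
  assumes "u \<in> weyl_group \<Phi>"
  obtains as where "set as \<subseteq> \<Delta>" "u = reflection_word as" "length as = weyl_length \<Delta> u"
proof -
  have "\<exists>n ss. set ss \<subseteq> root_reflection ` \<Delta> \<and> word_prod ss = u \<and> length ss = n"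
    using assms unfolding weyl_group_words word_prod_reflections[symmetric] by auto
  from LeastI_ex[OF this] obtain ss where
    shortest: "set ss \<subseteq> root_reflection ` \<Delta>" "word_prod ss = u" "length ss = weyl_length \<Delta> u"
    unfolding weyl_length_def by blast
  then have "ss \<in> map root_reflection ` lists \<Delta>" unfolding lists_image[symmetric] by auto
  then obtain as where as: "set as \<subseteq> \<Delta>" "ss = map root_reflection as" by auto
  with shortest show thesis by (intro that[of as]) (simp_all add: reflection_word_def)
qed

lemma exchange_condition:
  assumes "set as \<subseteq> \<Delta>" "b \<in> pos" "reflection_word as b \<notin> pos"
  shows "\<exists>xs a ys. as = xs @ a # ys \<and>
    reflection_word as \<circ> root_reflection b = reflection_word (xs @ ys)"
  using assms
proof (induction as)
  case (Cons a as)
  show ?case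
  proof (cases "reflection_word as b \<in> pos")
    case True
    then have "reflection_word as b = a"
      using simple_reflection_positive[of a "reflection_word as b"] Cons.prems by auto
    then have "root_reflection a =
        reflection_word as \<circ> root_reflection b \<circ> reflection_word (rev as)"
      using root_reflection_word_conjugate by metis
    then have "reflection_word (a # as) \<circ> root_reflection b = reflection_word ([] @ as)"
      by (simp add: fun_eq_iff)
    then show ?thesis by blast
  next
    case False
    then obtain xs c ys where deletion: "as = xs @ c # ys"
      "reflection_word as \<circ> root_reflection b = reflection_word (xs @ ys)"
      using Cons.IH[OF _ Cons.prems(2)] Cons.prems(1) unfolding set_simps insert_subset by blast
    then have "reflection_word (a # as) \<circ> root_reflection b = reflection_word ((a # xs) @ ys)"
      by (simp add: comp_assoc)
    moreover have "a # as = (a # xs) @ c # ys" using deletion(1) by simp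
    ultimately show ?thesis by blast
  qed
qed simp

lemma weyl_length_reflection_less:
  assumes u: "u \<in> weyl_group \<Phi>" and b: "b \<in> pos" "u b \<notin> pos"
  shows "weyl_length \<Delta> (u \<circ> root_reflection b) < weyl_length \<Delta> u"
proof -
  obtain as where reduced: "set as \<subseteq> \<Delta>" "u = reflection_word as" "length as = weyl_length \<Delta> u"
    using u by (rule reduced_word)
  then obtain xs a ys where split: "as = xs @ a # ys"
    and exchanged: "u \<circ> root_reflection b = reflection_word (xs @ ys)"
    using exchange_condition[OF reduced(1) b(1)] b(2) by blast
  have "weyl_length \<Delta> (u \<circ> root_reflection b) \<le> length (xs @ ys)"
    unfolding exchanged using reduced(1) split by (intro weyl_length_le) auto
  also have "\<dots> < weyl_length \<Delta> u" using reduced(3) split by simp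
  finally show ?thesis .
qed

lemma bruhat_step_deletion:
  assumes step: "bruhat_step \<Phi> \<Delta> u (reflection_word as)" and as: "set as \<subseteq> \<Delta>"
  shows "\<exists>xs a ys. as = xs @ a # ys \<and> u = reflection_word (xs @ ys)"
proof -
  obtain b where u_weyl: "u \<in> weyl_group \<Phi>" and "b \<in> \<Phi>"
    and v_eq: "reflection_word as = u \<circ> root_reflection b"
    and length_less: "weyl_length \<Delta> u < weyl_length \<Delta> (reflection_word as)"
    using step unfolding bruhat_step_def by blast
  obtain c where c_positive: "c \<in> pos" "root_reflection b = root_reflection c"
    using positive_or_negative[OF \<open>b \<in> \<Phi>\<close>] root_reflection_uminus[of b, symmetric] by blast
  have u_eq: "u = reflection_word as \<circ> root_reflection c"
    unfolding v_eq c_positive(2) by (simp add: comp_assoc)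
  have "c \<noteq> 0" using positive_root[OF c_positive(1)] by (rule root_nonzero)
  then have "u c = - reflection_word as c"
    by (simp add: u_eq root_reflection_self linear_neg[OF linear_reflection_word])
  moreover have "u c \<in> pos"
    using weyl_length_reflection_less[OF u_weyl c_positive(1)] length_less
    unfolding v_eq c_positive(2) by force
  ultimately have "reflection_word as c \<notin> pos" using uminus_not_positive by fastforce
  from exchange_condition[OF as c_positive(1) this] show ?thesis unfolding u_eq .
qed

end

subsection \<open>Products of distinct simple reflections\<close>

text \<open>
  In a word with distinct letters, these are the letters that can be moved to the end by exchanging
  adjacent commuting letters.
\<close>

definition final_letter :: "'a::real_inner list \<Rightarrow> 'a \<Rightarrow> bool" where
  "final_letter bs b \<longleftrightarrow> (\<exists>xs ys. bs = xs @ b # ys \<and> (\<forall>c\<in>set ys. b \<bullet> c = 0))"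

lemma final_letter_Cons:
  "final_letter (b # bs) c \<longleftrightarrow> c = b \<and> (\<forall>d\<in>set bs. b \<bullet> d = 0) \<or> final_letter bs c"
proof
  assume "final_letter (b # bs) c"
  then show "c = b \<and> (\<forall>d\<in>set bs. b \<bullet> d = 0) \<or> final_letter bs c"
    unfolding final_letter_def Cons_eq_append_conv by blast
next
  assume "c = b \<and> (\<forall>d\<in>set bs. b \<bullet> d = 0) \<or> final_letter bs c"
  then show "final_letter (b # bs) c"
    unfolding final_letter_def by (metis append_Cons append_Nil)
qed

context based_root_system
begin

lemma span_base_subset: "v \<in> span S \<Longrightarrow> S \<subseteq> \<Delta> \<Longrightarrow> v \<in> span \<Delta>"
  using span_mono by blast

lemma coeff_outside_span:
  assumes "v \<in> span S" "S \<subseteq> \<Delta>" "a \<notin> S"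
  shows "coeff v a = 0"
  using real_vector.representation_extend[OF independent_base assms(1,2)]
    real_vector.representation_ne_zero[of S v a] assms(3) by metis

lemma inner_expansion:
  assumes v: "v \<in> span S" and S: "S \<subseteq> \<Delta>"
  shows "v \<bullet> b = (\<Sum>a\<in>S. coeff v a * (a \<bullet> b))"
proof -
  have "(\<Sum>a\<in>S. coeff v a *\<^sub>R a) = (\<Sum>a\<in>\<Delta>. coeff v a *\<^sub>R a)"
    using S by (intro sum.mono_neutral_left finite_base) (simp_all add: coeff_outside_span[OF v S])
  also have "\<dots> = v" using span_base_subset[OF v S] by (rule base_expansion)
  finally have "v \<bullet> b = (\<Sum>a\<in>S. coeff v a *\<^sub>R a) \<bullet> b" by simp
  then show ?thesis by (simp add: inner_sum_left)
qed

lemma positive_combination_obtuse: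
  assumes v_positive: "v \<in> span S" "\<And>a. a \<in> S \<Longrightarrow> 0 < coeff v a" and S: "S \<subseteq> \<Delta>"
    and b: "b \<in> \<Delta>" "b \<notin> S"
  shows "v \<bullet> b \<le> 0" "c \<in> S \<Longrightarrow> b \<bullet> c \<noteq> 0 \<Longrightarrow> v \<bullet> b < 0"
proof -
  have expand: "v \<bullet> b = (\<Sum>a\<in>S. coeff v a * (a \<bullet> b))"
    using v_positive(1) S by (rule inner_expansion)
  have nonpos: "coeff v a * (a \<bullet> b) \<le> 0" if "a \<in> S" for a
    using v_positive(2)[OF that] base_obtuse[of a b] that b S by (force simp: mult_le_0_iff)
  then show "v \<bullet> b \<le> 0" unfolding expand by (rule sum_nonpos)
  assume not_orthogonal: "c \<in> S" "b \<bullet> c \<noteq> 0"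
  then have "coeff v c * (c \<bullet> b) < 0"
    using nonpos[OF not_orthogonal(1)] v_positive(2)[OF not_orthogonal(1)]
    by (simp add: inner_commute less_le)
  then have "(\<Sum>a\<in>S. coeff v a * (a \<bullet> b)) < (\<Sum>a\<in>S. 0)"
    using nonpos not_orthogonal(1) finite_subset[OF S finite_base]
    by (intro sum_strict_mono_ex1) auto
  then show "v \<bullet> b < 0" unfolding expand by simp
qed

text \<open>
  Distinct simple roots are at obtuse angles, so the contributions of the letters to the
  displacement of an antidominant vector never cancel.
\<close>

lemma antidominant_displacement_positive:
  assumes "set bs \<subseteq> \<Delta>" "distinct bs" "\<forall>b\<in>set bs. x \<bullet> b \<le> 0"
    and "\<And>b. final_letter bs b \<Longrightarrow> x \<bullet> b < 0" and "a \<in> set bs"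
  shows "0 < coeff (reflection_word bs x - x) a"
  using assms
proof (induction bs arbitrary: a)
  case (Cons b bs)
  define v where "v = reflection_word bs x - x"
  have bs: "set bs \<subseteq> \<Delta>" and b: "b \<in> \<Delta>" "b \<notin> set bs" using Cons.prems(1,2) by auto
  have v_span: "v \<in> span (set bs)" unfolding v_def by (rule reflection_word_diff_span)
  have v_pos: "0 < coeff v c" if "c \<in> set bs" for c
    unfolding v_def using that Cons.prems by (intro Cons.IH) (auto simp: final_letter_Cons)
  note obtuse = positive_combination_obtuse[OF v_span v_pos bs b]
  have "x \<bullet> b + v \<bullet> b < 0"
  proof (cases "\<exists>c\<in>set bs. b \<bullet> c \<noteq> 0")
    case True
    then have "v \<bullet> b < 0" using obtuse(2) by blast
    then show ?thesis using Cons.prems(3) by force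
  next
    case False
    then have "x \<bullet> b < 0" using Cons.prems(4) by (auto simp: final_letter_Cons)
    then show ?thesis using obtuse(1) by simp
  qed
  moreover define k where "k = - (2 * (reflection_word bs x \<bullet> b) / (b \<bullet> b))"
  ultimately have "0 < k"
    using base_inner_self[OF b(1)] by (simp add: v_def inner_diff_left divide_less_0_iff)
  moreover have "reflection_word (b # bs) x - x = v + k *\<^sub>R b"
    by (simp add: root_reflection_def v_def k_def)
  moreover have "coeff (v + k *\<^sub>R b) a = coeff v a + (if a = b then k else 0)"
    using span_base_subset[OF v_span bs] b(1) by (rule coeff_add_base)
  moreover have "coeff v b = 0" using v_span bs b(2) by (rule coeff_outside_span)
  ultimately show ?case using v_pos[of a] Cons.prems(5) b(2) by (cases "a = b") simp_all
qed simp

lemma coset_word_letters: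
  assumes bs: "set bs \<subseteq> \<Delta>" "distinct bs" and no_final: "\<forall>b\<in>I. \<not> final_letter bs b"
    and us: "set us \<subseteq> I" "I \<subseteq> \<Delta>" and cs: "set cs \<subseteq> \<Delta>"
    and product_eq: "reflection_word bs \<circ> reflection_word us = reflection_word cs"
  shows "set bs \<subseteq> set cs"
proof
  fix b assume b: "b \<in> set bs"
  obtain x where antidominant: "\<forall>a\<in>\<Delta>. x \<bullet> a = (if a \<in> I then 0 else - 1)"
    using ex_prescribed_inner[OF independent_base, of "\<lambda>a. if a \<in> I then 0 else - 1"] by blast
  have "\<forall>c\<in>set bs. x \<bullet> c \<le> 0" using antidominant bs(1) by (simp add: subset_iff)
  moreover have "x \<bullet> c < 0" if c: "final_letter bs c" for c
  proof -
    have "c \<in> set bs" using c by (auto simp: final_letter_def)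
    with c no_final bs(1) have "c \<in> \<Delta>" "c \<notin> I" by auto
    with antidominant show ?thesis by simp
  qed
  ultimately have "0 < coeff (reflection_word bs x - x) b"
    using bs b by (intro antidominant_displacement_positive)
  moreover have "\<forall>a\<in>set us. x \<bullet> a = 0" using antidominant us by (simp add: subset_iff)
  then have "reflection_word us x = x" by (rule reflection_word_fixes)
  then have "reflection_word bs x = reflection_word cs x"
    using fun_cong[OF product_eq, of x] by simp
  ultimately have "coeff (reflection_word cs x - x) b \<noteq> 0" by simp
  then show "b \<in> set cs" using coeff_outside_span[OF reflection_word_diff_span cs] by blast
qed

lemma coset_word_length_ge:
  assumes bs: "set bs \<subseteq> \<Delta>" "distinct bs" and "\<forall>b\<in>I. \<not> final_letter bs b"
    and us: "set us \<subseteq> I" "I \<subseteq> \<Delta>"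
  shows "length bs \<le> weyl_length \<Delta> (reflection_word bs \<circ> reflection_word us)"
proof -
  have "reflection_word bs \<circ> reflection_word us \<in> weyl_group \<Phi>"
    unfolding weyl_group_words using bs us by (intro image_eqI[of _ _ "bs @ us"]) auto
  then obtain cs where reduced: "set cs \<subseteq> \<Delta>"
    "reflection_word bs \<circ> reflection_word us = reflection_word cs"
    "length cs = weyl_length \<Delta> (reflection_word bs \<circ> reflection_word us)"
    by (rule reduced_word)
  have "length bs = card (set bs)" using bs(2) by (simp add: distinct_card)
  also have "\<dots> \<le> card (set cs)"
    using coset_word_letters[OF assms reduced(1,2)] by (simp add: card_mono)
  also have "\<dots> \<le> length cs" by (rule card_length)
  finally show ?thesis unfolding reduced(3) .
qed

lemma weyl_length_distinct_word:
  assumes "set bs \<subseteq> \<Delta>" "distinct bs"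
  shows "weyl_length \<Delta> (reflection_word bs) = length bs"
  using weyl_length_le[OF assms(1)] coset_word_length_ge[OF assms, of "{}" "[]"] by simp

lemma distinct_word_letters:
  assumes "set bs \<subseteq> \<Delta>" "distinct bs" "set cs \<subseteq> \<Delta>" "distinct cs"
    and "reflection_word bs = reflection_word cs"
  shows "set bs = set cs"
  using coset_word_letters[of bs "{}" "[]" cs] coset_word_letters[of cs "{}" "[]" bs] assms by simp

lemma final_letter_cancel:
  assumes "final_letter bs b"
  obtains xs ys where "bs = xs @ b # ys"
    "reflection_word bs \<circ> root_reflection b = reflection_word (xs @ ys)"
proof -
  obtain xs ys where split: "bs = xs @ b # ys" and commute: "\<forall>c\<in>set ys. b \<bullet> c = 0"
    using assms by (auto simp: final_letter_def)
  moreover have "reflection_word bs \<circ> root_reflection b = reflection_word (xs @ ys)"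
    using reflection_word_commute[OF commute] by (simp add: split fun_eq_iff)
  ultimately show thesis by (intro that)
qed

abbreviation parabolic_base :: "'a set \<Rightarrow> 'a set" where
  "parabolic_base \<Psi> \<equiv> {a \<in> \<Delta>. - a \<in> \<Psi>}"

lemma min_coset_rep_distinct_word_iff:
  assumes bs: "set bs \<subseteq> \<Delta>" "distinct bs"
  shows "reflection_word bs \<in> min_coset_reps \<Phi> \<Delta> \<Psi> \<longleftrightarrow>
    (\<forall>b\<in>parabolic_base \<Psi>. \<not> final_letter bs b)"
proof
  have parabolic: "parabolic_weyl \<Delta> \<Psi> = reflection_word ` lists (parabolic_base \<Psi>)"
    unfolding parabolic_weyl_def by (rule generate_reflections)
  have length_eq: "weyl_length \<Delta> (reflection_word bs) = length bs"
    using bs by (rule weyl_length_distinct_word)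
  show "reflection_word bs \<in> min_coset_reps \<Phi> \<Delta> \<Psi>"
    if no_final: "\<forall>b\<in>parabolic_base \<Psi>. \<not> final_letter bs b"
    unfolding min_coset_reps_def parabolic length_eq mem_Collect_eq
  proof (intro conjI ballI)
    show "reflection_word bs \<in> weyl_group \<Phi>" using bs(1) by (auto simp: weyl_group_words)
    fix u assume "u \<in> reflection_word ` lists (parabolic_base \<Psi>)"
    then obtain us where us: "set us \<subseteq> parabolic_base \<Psi>" "u = reflection_word us" by auto
    show "length bs \<le> weyl_length \<Delta> (reflection_word bs \<circ> u)"
      unfolding us(2) using bs no_final us(1) by (rule coset_word_length_ge) blast
  qed
  show "\<forall>b\<in>parabolic_base \<Psi>. \<not> final_letter bs b"
    if minimal: "reflection_word bs \<in> min_coset_reps \<Phi> \<Delta> \<Psi>"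
  proof (intro ballI notI)
    fix b assume b: "b \<in> parabolic_base \<Psi>" and "final_letter bs b"
    from this(2) obtain xs ys where split: "bs = xs @ b # ys"
      and cancel: "reflection_word bs \<circ> root_reflection b = reflection_word (xs @ ys)"
      by (rule final_letter_cancel)
    have "root_reflection b \<in> parabolic_weyl \<Delta> \<Psi>"
      unfolding parabolic_weyl_def using b by (intro generate.incl imageI)
    then have "length bs \<le> weyl_length \<Delta> (reflection_word (xs @ ys))"
      using minimal unfolding min_coset_reps_def length_eq[symmetric] cancel[symmetric] by blast
    also have "\<dots> \<le> length (xs @ ys)" using bs(1) split by (intro weyl_length_le) auto
    finally show False using split by simp
  qed
qed

lemma bruhat_step_insert:
  assumes "set (xs @ a # ys) \<subseteq> \<Delta>" "distinct (xs @ a # ys)"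
  shows "bruhat_step \<Phi> \<Delta> (reflection_word (xs @ ys)) (reflection_word (xs @ a # ys))"
proof -
  let ?b = "reflection_word (rev ys) a"
  have "reflection_word (xs @ a # ys) = reflection_word (xs @ ys) \<circ> root_reflection ?b"
    by (simp add: root_reflection_word_conjugate fun_eq_iff)
  moreover have "?b \<in> \<Phi>" using assms(1) base_subset by (intro reflection_word_root) auto
  moreover have "reflection_word (xs @ ys) \<in> weyl_group \<Phi>"
    unfolding weyl_group_words using assms(1) by (intro imageI) auto
  moreover have "weyl_length \<Delta> (reflection_word (xs @ ys)) <
      weyl_length \<Delta> (reflection_word (xs @ a # ys))"
    using weyl_length_distinct_word[of "xs @ ys"] weyl_length_distinct_word[of "xs @ a # ys"] assms
    by simp
  ultimately show ?thesis unfolding bruhat_step_def by blast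
qed

end

subsection \<open>Subwords of a Coxeter-type element\<close>

lemma nths_split_at:
  assumes "k < length xs"
  shows "nths xs A =
    nths xs (A \<inter> {..<k}) @ (if k \<in> A then [xs ! k] else []) @ nths xs (A \<inter> {k<..})"
  using assms
proof (induction xs arbitrary: k A)
  case (Cons x xs)
  show ?case
  proof (cases k)
    case 0
    then show ?thesis by (simp add: nths_Cons)
  next
    case (Suc m)
    have "{j. Suc j \<in> A \<inter> {..<Suc m}} = {j. Suc j \<in> A} \<inter> {..<m}"
      "{j. Suc j \<in> A \<inter> {Suc m<..}} = {j. Suc j \<in> A} \<inter> {m<..}"
      by auto
    with Cons.IH[of m "{j. Suc j \<in> A}"] Cons.prems Suc show ?thesis by (simp add: nths_Cons)
  qed
qed simp

lemma nths_Diff_singleton: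
  assumes "k < length xs"
  shows "nths xs (A - {k}) = nths xs (A \<inter> {..<k}) @ nths xs (A \<inter> {k<..})"
proof -
  have "(A - {k}) \<inter> {..<k} = A \<inter> {..<k}" "(A - {k}) \<inter> {k<..} = A \<inter> {k<..}" by auto
  then show ?thesis using nths_split_at[OF assms, of "A - {k}"] by simp
qed

lemma nths_eq_append_Cons_iff:
  assumes "distinct zs"
  shows "nths zs A = xs @ a # ys \<longleftrightarrow>
    (\<exists>k\<in>A. k < length zs \<and> a = zs ! k \<and> xs = nths zs (A \<inter> {..<k}) \<and> ys = nths zs (A \<inter> {k<..}))"
proof
  assume split: "nths zs A = xs @ a # ys"
  then have "a \<in> set (nths zs A)" by simp
  then obtain k where k: "k \<in> A" "k < length zs" "a = zs ! k" by (auto simp: set_nths)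
  then have split_at_k: "nths zs A = nths zs (A \<inter> {..<k}) @ a # nths zs (A \<inter> {k<..})"
    using nths_split_at[of k zs A] by simp
  then have "a \<notin> set (nths zs (A \<inter> {..<k}))" "a \<notin> set (nths zs (A \<inter> {k<..}))"
    using distinct_nthsI[OF assms, of A] by simp_all
  then have "xs = nths zs (A \<inter> {..<k})" "ys = nths zs (A \<inter> {k<..})"
    using split_at_k unfolding split by (metis append_Cons_eq_iff)+
  with k show "\<exists>k\<in>A. k < length zs \<and> a = zs ! k \<and>
      xs = nths zs (A \<inter> {..<k}) \<and> ys = nths zs (A \<inter> {k<..})"
    by blast
next
  assume "\<exists>k\<in>A. k < length zs \<and> a = zs ! k \<and>
      xs = nths zs (A \<inter> {..<k}) \<and> ys = nths zs (A \<inter> {k<..})"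
  then show "nths zs A = xs @ a # ys" using nths_split_at[of _ zs A] by auto
qed

locale coxeter_word = based_root_system +
  fixes as :: "'a list"
  assumes letters: "set as \<subseteq> \<Delta>" and distinct: "distinct as"
begin

abbreviation positions :: "nat set" where
  "positions \<equiv> {..<length as}"

abbreviation subword :: "nat set \<Rightarrow> 'a \<Rightarrow> 'a" where
  "subword A \<equiv> reflection_word (nths as A)"

lemma set_nths_base: "set (nths as A) \<subseteq> \<Delta>"
  using letters set_nths_subset by (rule order_trans[rotated])

lemma distinct_nths: "distinct (nths as A)"
  using distinct by (rule distinct_nthsI)

lemma subword_positions: "subword positions = reflection_word as"
  by (simp add: nths_all)

lemma subword_inj:
  assumes "A \<subseteq> positions" "B \<subseteq> positions" "subword A = subword B"
  shows "A = B"
proof -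
  have "(!) as ` A = set (nths as A)" "(!) as ` B = set (nths as B)"
    using assms(1,2) by (auto simp: set_nths)
  then have "(!) as ` A = (!) as ` B"
    using distinct_word_letters[OF set_nths_base distinct_nths set_nths_base distinct_nths assms(3)]
    by simp
  moreover have "inj_on ((!) as) positions"
    using distinct by (simp add: inj_on_def nth_eq_iff_index_eq)
  ultimately show ?thesis using inj_on_image_eq_iff assms(1,2) by blast
qed

lemma bruhat_le_subwordE:
  assumes "bruhat_le \<Phi> \<Delta> v (subword B)"
  obtains A where "A \<subseteq> B" "v = subword A"
proof -
  have "\<exists>A\<subseteq>B. v = subword A"
    using assms unfolding bruhat_le_def
  proof (induction rule: converse_rtranclp_induct)
    case (step v u)
    then obtain A where A: "A \<subseteq> B" "u = subword A" by blast
    have "bruhat_step \<Phi> \<Delta> v (subword A)" using step.hyps(1) unfolding A(2) .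
    from bruhat_step_deletion[OF this set_nths_base] obtain xs a ys
      where split: "nths as A = xs @ a # ys" "v = reflection_word (xs @ ys)" by blast
    then obtain k where "k < length as"
      "xs = nths as (A \<inter> {..<k})" "ys = nths as (A \<inter> {k<..})"
      unfolding nths_eq_append_Cons_iff[OF distinct] by blast
    then have "v = subword (A - {k})" unfolding split(2) by (simp only: nths_Diff_singleton)
    then show ?case using A(1) by blast
  qed blast
  then show thesis using that by blast
qed

lemma bruhat_step_subword_insert:
  assumes "k < length as" "k \<notin> A"
  shows "bruhat_step \<Phi> \<Delta> (subword A) (subword (insert k A))"
proof -
  let ?xs = "nths as (A \<inter> {..<k})" and ?ys = "nths as (A \<inter> {k<..})"
  have "nths as A = ?xs @ ?ys" using nths_Diff_singleton[OF assms(1), of A] assms(2) by simp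
  moreover have insert: "nths as (insert k A) = ?xs @ as ! k # ?ys"
    using nths_split_at[OF assms(1), of "insert k A"] by simp
  moreover have "set (?xs @ as ! k # ?ys) \<subseteq> \<Delta>" "distinct (?xs @ as ! k # ?ys)"
    unfolding insert[symmetric] by (rule set_nths_base distinct_nths)+
  ultimately show ?thesis using bruhat_step_insert by metis
qed

lemma bruhat_le_subword_mono:
  assumes "A \<subseteq> B" "B \<subseteq> positions"
  shows "bruhat_le \<Phi> \<Delta> (subword A) (subword B)"
proof -
  have "bruhat_le \<Phi> \<Delta> (subword A) (subword (A \<union> C))" if "finite C" "C \<subseteq> positions" for C
    using that
  proof (induction C)
    case empty
    show ?case by (simp add: bruhat_le_def)
  next
    case (insert k C)
    then have IH: "bruhat_le \<Phi> \<Delta> (subword A) (subword (A \<union> C))" by blast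
    show ?case
    proof (cases "k \<in> A \<union> C")
      case True
      with IH show ?thesis by (simp add: insert_absorb)
    next
      case False
      then have "bruhat_step \<Phi> \<Delta> (subword (A \<union> C)) (subword (insert k (A \<union> C)))"
        using insert.prems by (intro bruhat_step_subword_insert) auto
      with IH show ?thesis by (simp add: bruhat_le_def)
    qed
  qed
  from this[of B] assms show ?thesis by (simp add: finite_subset Un_absorb1)
qed

lemma bruhat_le_subword_iff:
  assumes "A \<subseteq> positions" "B \<subseteq> positions"
  shows "bruhat_le \<Phi> \<Delta> (subword A) (subword B) \<longleftrightarrow> A \<subseteq> B"
proof
  assume "bruhat_le \<Phi> \<Delta> (subword A) (subword B)"
  then obtain C where "C \<subseteq> B" "subword A = subword C" by (rule bruhat_le_subwordE)
  moreover from this have "A = C" using assms by (intro subword_inj) auto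
  ultimately show "A \<subseteq> B" by simp
next
  assume "A \<subseteq> B"
  then show "bruhat_le \<Phi> \<Delta> (subword A) (subword B)"
    using assms(2) by (rule bruhat_le_subword_mono)
qed

definition feasible :: "'a set \<Rightarrow> nat set set" where
  "feasible I = {A. A \<subseteq> positions \<and> (\<forall>i\<in>A. as ! i \<in> I \<longrightarrow> (\<exists>j\<in>A. i < j \<and> as ! i \<bullet> as ! j \<noteq> 0))}"

lemma feasible_iff_final_letter:
  assumes "A \<subseteq> positions"
  shows "A \<in> feasible I \<longleftrightarrow> (\<forall>b\<in>I. \<not> final_letter (nths as A) b)"
proof -
  have "final_letter (nths as A) b \<longleftrightarrow>
      (\<exists>i\<in>A. i < length as \<and> b = as ! i \<and> (\<forall>c\<in>set (nths as (A \<inter> {i<..})). as ! i \<bullet> c = 0))" for b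
    unfolding final_letter_def nths_eq_append_Cons_iff[OF distinct] by blast
  moreover have "set (nths as (A \<inter> {i<..})) = (!) as ` {j \<in> A. i < j}" for i
    using assms by (auto simp: set_nths)
  ultimately have final: "final_letter (nths as A) b \<longleftrightarrow>
      (\<exists>i\<in>A. b = as ! i \<and> (\<forall>j\<in>A. i < j \<longrightarrow> as ! i \<bullet> as ! j = 0))" for b
    using assms by auto
  show ?thesis unfolding feasible_def mem_Collect_eq final using assms by blast
qed

lemma min_coset_rep_subword_iff:
  assumes "A \<subseteq> positions"
  shows "subword A \<in> min_coset_reps \<Phi> \<Delta> \<Psi> \<longleftrightarrow> A \<in> feasible (parabolic_base \<Psi>)"
  unfolding min_coset_rep_distinct_word_iff[OF set_nths_base distinct_nths]
    feasible_iff_final_letter[OF assms] ..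

text \<open>
  The condition defining \<open>feasible\<close> looks only at larger positions, so the total order of the
  antimatroid is the reversed order of positions.
\<close>

lemma feasible_antimatroid:
  "supersolvable_antimatroid positions (feasible I) {(i, j). i < length as \<and> j \<le> i}"
  unfolding supersolvable_antimatroid_def
proof (intro conjI ballI impI)
  show "linear_order_on positions {(i, j). i < length as \<and> j \<le> i}"
    by (auto simp: order_on_defs refl_on_def trans_def antisym_def total_on_def)
  fix A B x
  assume A: "A \<in> feasible I" and B: "B \<in> feasible I" and x: "x \<in> B - A"
    and max: "\<forall>y\<in>B - A. (x, y) \<in> {(i, j). i < length as \<and> j \<le> i}"
  have "\<exists>j\<in>insert x A. x < j \<and> as ! x \<bullet> as ! j \<noteq> 0" if "as ! x \<in> I"
  proof -
    obtain j where j: "j \<in> B" "x < j" "as ! x \<bullet> as ! j \<noteq> 0"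
      using B x \<open>as ! x \<in> I\<close> by (auto simp: feasible_def)
    then have "j \<in> A" using max by force
    with j show ?thesis by blast
  qed
  then show "insert x A \<in> feasible I" using A B x by (auto simp: feasible_def)
qed (auto simp: feasible_def)

definition word_positions :: "'a set \<Rightarrow> ('a \<Rightarrow> 'a) \<Rightarrow> nat set" where
  "word_positions I = inv_into (feasible I) subword"

lemma bij_betw_subword_bruhat_interval:
  "bij_betw subword (feasible (parabolic_base \<Psi>))
     (carrier (bruhat_interval \<Phi> \<Delta> \<Psi> (reflection_word as)))"
proof -
  let ?F = "feasible (parabolic_base \<Psi>)"
  let ?C = "{v \<in> min_coset_reps \<Phi> \<Delta> \<Psi>. bruhat_le \<Phi> \<Delta> v (subword positions)}"
  have feasible_subset: "A \<subseteq> positions" if "A \<in> ?F" for A using that by (simp add: feasible_def)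
  have "subword A \<in> ?C" if "A \<in> ?F" for A
    using that feasible_subset[OF that] min_coset_rep_subword_iff bruhat_le_subword_mono by blast
  moreover have "v \<in> subword ` ?F" if v: "v \<in> ?C" for v
  proof -
    from v obtain A where "A \<subseteq> positions" "v = subword A"
      using bruhat_le_subwordE by blast
    with v show ?thesis using min_coset_rep_subword_iff by blast
  qed
  moreover have "inj_on subword ?F" by (intro inj_onI subword_inj feasible_subset)
  ultimately have "bij_betw subword ?F ?C" unfolding bij_betw_def by blast
  then show ?thesis by (simp add: bruhat_interval_def subword_positions)
qed

lemma bruhat_interval_order_iso:
  fixes \<Psi> :: "'a set"
  defines "I \<equiv> parabolic_base \<Psi>" and "L \<equiv> bruhat_interval \<Phi> \<Delta> \<Psi> (reflection_word as)"
  shows "partial_order L" "order_iso L (inclusion_order (feasible I)) (word_positions I)"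
proof -
  have bij: "bij_betw subword (feasible I) (carrier L)"
    unfolding I_def L_def by (rule bij_betw_subword_bruhat_interval)
  have eq: "eq L = (=)" by (simp add: L_def bruhat_interval_def)
  have bij_inv: "bij_betw (word_positions I) (carrier L) (feasible I)"
    unfolding word_positions_def using bij by (rule bij_betw_inv_into)
  have embedding: "x \<sqsubseteq>\<^bsub>L\<^esub> y \<longleftrightarrow> word_positions I x \<subseteq> word_positions I y"
    if x: "x \<in> carrier L" and y: "y \<in> carrier L" for x y
  proof -
    have "word_positions I z \<subseteq> positions" "subword (word_positions I z) = z"
      if "z \<in> carrier L" for z
      using that bij_inv bij_betw_inv_into_right[OF bij]
      by (auto simp: bij_betw_def feasible_def word_positions_def)
    with bruhat_le_subword_iff[of "word_positions I x" "word_positions I y"] x y show ?thesis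
      by (simp add: L_def bruhat_interval_def)
  qed
  show "partial_order L" "order_iso L (inclusion_order (feasible I)) (word_positions I)"
    by (rule order_iso_inclusion_orderI[OF eq bij_inv embedding]; assumption)+
qed

end

lemma coxeter_typeE:
  assumes "coxeter_type \<Delta> w"
  obtains as where "set as \<subseteq> \<Delta>" "distinct as" "w = reflection_word as"
proof -
  obtain ss where ss: "distinct ss" "ss \<in> lists (root_reflection ` \<Delta>)" "w = word_prod ss"
    using assms by (auto simp: coxeter_type_def)
  then obtain as where "as \<in> lists \<Delta>" "ss = map root_reflection as"
    unfolding lists_image by blast
  with ss show thesis by (intro that[of as]) (auto simp: distinct_map reflection_word_def)
qed

theorem theorem5p4:
  fixes \<Phi> \<Delta> \<Psi> :: "'a::euclidean_space set" and w :: "'a \<Rightarrow> 'a"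
  assumes "root_system \<Phi>"
    and "root_base \<Phi> \<Delta>"
    and "standard_parabolic \<Phi> \<Delta> \<Psi>"
    and "w \<in> min_coset_reps \<Phi> \<Delta> \<Psi>"
    and "coxeter_type \<Delta> w"
  shows "(\<exists>(E::nat set) F r f. supersolvable_antimatroid E F r \<and>
            order_iso (bruhat_interval \<Phi> \<Delta> \<Psi> w) (inclusion_order F) f) \<and>
         join_distributive_lattice (bruhat_interval \<Phi> \<Delta> \<Psi> w) \<and>
         supersolvable_lattice (bruhat_interval \<Phi> \<Delta> \<Psi> w)"
proof -
  obtain as where as: "set as \<subseteq> \<Delta>" "distinct as" and w: "w = reflection_word as"
    using assms(5) by (rule coxeter_typeE)
  interpret coxeter_word \<Phi> \<Delta> as
    by unfold_locales (fact assms(1,2) as)+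
  let ?I = "parabolic_base \<Psi>"
  let ?L = "bruhat_interval \<Phi> \<Delta> \<Psi> w"
  have interval_iso: "partial_order ?L"
    "order_iso ?L (inclusion_order (feasible ?I)) (word_positions ?I)"
    unfolding w by (rule bruhat_interval_order_iso)+
  interpret antimatroid_lattice positions "feasible ?I" "{(i, j). i < length as \<and> j \<le> i}" ?L
    "word_positions ?I"
    by (intro antimatroid_lattice.intro armstrong_antimatroid.intro
        antimatroid_lattice_axioms.intro feasible_antimatroid interval_iso)
  show ?thesis
    using feasible_antimatroid interval_iso(2) join_distributive supersolvable by blast
qed

end
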